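(* Let $D\in A=\mathbb F_q[t]$ be a non-constant square-free polynomial. Then $$\lim_{l\to\infty} \frac{1}{q^l} \sum_{\substack{m\in A,\ \deg m=l\\ \gcd(m,D)=1}} L(1,\chi_{Dm})= \frac{M_D(1)M_D(2)}{M_D(3)}\,q\,(1-q^{-2}),$$ where the sum runs over all (not necessarily monic) polynomials $m$ of degree $l$ relatively prime to $D$.
   Context: $q$ is an odd prime power and $A=\mathbb F_q[t]$; $|a|=q^{\deg a}$ for $a\in A\setminus\{0\}$. For $b\in A\setminus\{0\}$ and $a\in A$ monic, $\chi_b(a)=\left(\frac{b}{a}\right)$ is the Legendre (Jacobi) symbol, multiplicative in $a$, and equal to $0$ when $\gcd(a,b)\ne1$. $L(s,\chi_b)=\sum_{a\text{ monic}}\chi_b(a)|a|^{-s}$; when $b$ is not a square this is a polynomial in $q^{-s}$ of degree at most $\deg b-1$, so $L(1,\chi_b)$ is defined. For $d\in A\setminus\{0\}$, $M_d(s)=\sum_{e\mid d,\ e\text{ monic}}\mu(e)|e|^{-s}=\prod_{p\mid d}(1-|p|^{-s})$, with $\mu$ the Möbius function and $p$ running over monic primes dividing $d$. *)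

theory Defs
  imports
    "HOL-Analysis.Analysis"
    "HOL-Computational_Algebra.Polynomial"
    "HOL-Computational_Algebra.Squarefree"
begin

text \<open>
  The field with \<open>q\<close> elements is a type \<open>'a\<close> of class \<^class>\<open>field\<close> and \<^class>\<open>finite\<close>,
  so \<open>q = CARD('a)\<close> (automatically a prime power) and \<open>A = 'a poly\<close>.
\<close>

abbreviation monic :: "'a::comm_semiring_1 poly \<Rightarrow> bool" where
  "monic a \<equiv> lead_coeff a = 1"

definition norm_poly :: "'a::{field,finite} poly \<Rightarrow> nat" where
  "norm_poly a = CARD('a) ^ degree a"

definition monic_prime_divisors :: "'a::{field,finite} poly \<Rightarrow> 'a poly set" where
  "monic_prime_divisors a = {p. monic p \<and> irreducible p \<and> p dvd a}"

text \<open>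
  The library's \<open>multiplicity\<close> and prime factorizations are unavailable here: they need
  \<open>'a poly\<close> to be a factorial semiring, which the library only provides for coefficient
  fields with additional gcd structure.
\<close>

definition multiplicity_poly :: "'a::{field,finite} poly \<Rightarrow> 'a poly \<Rightarrow> nat" where
  "multiplicity_poly p a = (GREATEST n. p ^ n dvd a)"

definition Legendre_symbol :: "'a::{field,finite} poly \<Rightarrow> 'a poly \<Rightarrow> int" where
  "Legendre_symbol b p =
     (if p dvd b then 0 else if \<exists>c. p dvd c ^ 2 - b then 1 else - 1)"

definition Jacobi_symbol :: "'a::{field,finite} poly \<Rightarrow> 'a poly \<Rightarrow> int" where
  "Jacobi_symbol b a =
     (\<Prod>p\<in>monic_prime_divisors a. Legendre_symbol b p ^ multiplicity_poly p a)"

text \<open>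
  The Dirichlet series is summed in order of degree, i.e. as a power series in \<open>q\<^sup>-\<^sup>s\<close>.
  If \<open>b\<close> is non-constant and not a square, the coefficient of \<open>q\<^sup>-\<^sup>n\<^sup>s\<close> vanishes for
  \<open>n \<ge> degree b\<close>, so this is the value of that polynomial in \<open>q\<^sup>-\<^sup>s\<close> at every complex \<open>s\<close>, in
  particular at \<open>s = 1\<close>, where the series is not absolutely convergent over the monic \<open>a\<close>.
\<close>

definition L_poly :: "complex \<Rightarrow> 'a::{field,finite} poly \<Rightarrow> complex" where
  "L_poly s b =
     (\<Sum>n. \<Sum>a | monic a \<and> degree a = n.
        of_int (Jacobi_symbol b a) * of_nat (norm_poly a) powr (- s))"

definition moebius_poly :: "'a::{field,finite} poly \<Rightarrow> int" where
  "moebius_poly e =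
     (if squarefree e then (- 1) ^ card (monic_prime_divisors e) else 0)"

definition M_poly :: "'a::{field,finite} poly \<Rightarrow> complex \<Rightarrow> complex" where
  "M_poly d s =
     (\<Sum>e | e dvd d \<and> monic e.
        of_int (moebius_poly e) * of_nat (norm_poly e) powr (- s))"

end

theory Submission
  imports "HOL-Algebra.Algebraic_Closure_Type" Defs
begin

text \<open>
  Since \<open>\<chi>\<^bsub>Dm\<^esub>(a)\<close> depends on \<open>a\<close>, up to a sign that is constant in each degree, only modulo \<open>Dm\<close>
  (reciprocity), its sums over monic \<open>a\<close> of degree \<open>n \<ge> deg(Dm)\<close> vanish, so \<open>L(1, \<chi>\<^bsub>Dm\<^esub>)\<close> is a
  finite sum and the order of summation over \<open>a\<close> and \<open>m\<close> can be exchanged. If \<open>a\<close> is not a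
  square, \<open>m \<mapsto> (m / a)\<close> on the \<open>m\<close> coprime to \<open>D\<close> is a nontrivial character modulo \<open>aD\<close>, and a
  Polya-Vinogradov bound makes its sum over \<open>m\<close> of degree \<open>l > deg a - deg D\<close> of size \<open>q ^ (l / 2)\<close>;
  in total these \<open>a\<close> contribute \<open>O(l q ^ (l / 2))\<close>. The squares \<open>a = b\<^sup>2\<close> give the main term, a count
  of the \<open>m\<close> coprime to \<open>Db\<close>: after division by \<open>q ^ l\<close> it tends to
  \<open>(q - 1) \<Sum>\<^sub>b |b| ^ (-2) \<phi>(Db) / |Db|\<close> over the monic \<open>b\<close> coprime to \<open>D\<close>, and \<open>\<phi> * 1 = |\<cdot>|\<close>
  evaluates this as a quotient of values of the zeta function of \<open>A\<close> without the factors at \<open>D\<close>.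
\<close>

section \<open>Polynomials over a finite field\<close>

text \<open>The character in \<open>m\<close> is in general imprimitive modulo \<open>a D\<close>,
  so its Gauss sums do not have constant modulus. An average takes the place of that fact: the
  square of a Gauss sum is the same at all unit multiples of \<open>y\<close>, and comparing it with
  the mean square loses only a factor \<open>q ^ e\<close> with \<open>deg y < e\<close>. As
  \<open>L(1, \<chi>)\<close> involves only \<open>deg a < deg D + l\<close>, the dual sum has
  \<open>deg y < deg a + deg D - l < 2 deg D\<close>, so the loss is bounded in \<open>l\<close>.
  Additive characters are avoided: the kernel is the indicator that a linear functional on the
  residues vanishes, so all these sums are real and only sizes of subspaces are counted.
  Multiplicativity in the upper argument and reciprocity have a common source: in the algebraic
  closure the symbol is a product, over the roots of its lower argument, of
  \<open>(q - 1) / 2\<close>-th powers of values. Equations there descend to integers because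
  \<open>-1\<close>, \<open>0\<close>, \<open>1\<close> stay distinct for odd \<open>q\<close>. The
  Euler factors at \<open>D\<close> are adjoined one at a time, by induction on the prime factors of
  the squarefree \<open>D\<close>.\<close>

lemma CARD_field_gt_1: "CARD('a::{field,finite}) > 1"
proof -
  have "card {0, 1 :: 'a} \<le> CARD('a)" by (rule card_mono) auto
  then show ?thesis by simp
qed

text \<open>A condition on coefficients instead of on \<open>degree\<close> puts \<open>0\<close> in
  the set for every \<open>n\<close>, so that it is a vector space of dimension \<open>n\<close>,
  also for \<open>n = 0\<close>.\<close>

definition deg_less :: "nat \<Rightarrow> 'a::zero poly set"
  where "deg_less n = {p. \<forall>i\<ge>n. coeff p i = 0}"

lemma deg_less_iff: "p \<in> deg_less n \<longleftrightarrow> p = 0 \<or> degree p < n"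
proof
  assume "p \<in> deg_less n"
  then show "p = 0 \<or> degree p < n"
    unfolding deg_less_def using leading_coeff_0_iff[of p] by (cases "degree p < n") auto
qed (auto simp: deg_less_def coeff_eq_0)

lemma deg_less_zero [simp]: "0 \<in> deg_less n"
  by (simp add: deg_less_iff)

lemma deg_less_0: "deg_less 0 = {0}"
  by (auto simp: deg_less_iff)

lemma deg_less_mono: "m \<le> n \<Longrightarrow> deg_less m \<subseteq> deg_less n"
  by (auto simp: deg_less_def)

lemma deg_less_add: "p \<in> deg_less n \<Longrightarrow> r \<in> deg_less n \<Longrightarrow> (p::'a::comm_monoid_add poly) + r \<in> deg_less n"
  and deg_less_diff: "u \<in> deg_less n \<Longrightarrow> v \<in> deg_less n \<Longrightarrow> (u::'b::ab_group_add poly) - v \<in> deg_less n"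
  and deg_less_smult: "w \<in> deg_less n \<Longrightarrow> smult c (w::'c::comm_semiring_0 poly) \<in> deg_less n"
  by (auto simp: deg_less_def)

lemma deg_less_Suc:
  "deg_less (Suc n) = (\<lambda>(c, p). pCons c p) ` (UNIV \<times> deg_less n)"
proof (intro equalityI subsetI)
  fix p :: "'a poly"
  assume p: "p \<in> deg_less (Suc n)"
  obtain c r where r: "p = pCons c r" by (cases p)
  have "coeff r i = 0" if "i \<ge> n" for i
    using p that by (auto simp: deg_less_def r coeff_pCons dest: spec[of _ "Suc i"])
  then show "p \<in> (\<lambda>(c, p). pCons c p) ` (UNIV \<times> deg_less n)"
    using r by (auto simp: deg_less_def)
qed (auto simp: deg_less_def coeff_pCons split: nat.split)

lemma
  shows finite_deg_less [simp, intro]: "finite (deg_less n :: 'a::{zero,finite} poly set)"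
    and card_deg_less: "card (deg_less n :: 'a poly set) = CARD('a) ^ n"
proof -
  have "finite (deg_less n :: 'a poly set) \<and> card (deg_less n :: 'a poly set) = CARD('a) ^ n"
  proof (induction n)
    case (Suc n)
    have "inj_on (\<lambda>(c, p). pCons c p) (UNIV \<times> (deg_less n :: 'a poly set))"
      by (auto simp: inj_on_def)
    with Suc show ?case
      by (simp add: deg_less_Suc card_image card_cartesian_product)
  qed (simp add: deg_less_0)
  then show "finite (deg_less n :: 'a poly set)" "card (deg_less n :: 'a poly set) = CARD('a) ^ n"
    by auto
qed

lemma degree_eq_conv_deg_less:
  "{m::'a::zero poly. m \<noteq> 0 \<and> degree m = l} = deg_less (Suc l) - deg_less l"
  by (auto simp: deg_less_iff)

lemma monic_degree_eq_image:
  "{a::'a::comm_ring_1 poly. monic a \<and> degree a = n} = (\<lambda>r. monom 1 n + r) ` deg_less n"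
proof (intro equalityI subsetI)
  fix a :: "'a poly" assume a: "a \<in> {a. monic a \<and> degree a = n}"
  have "a - monom 1 n \<in> deg_less n"
    using a by (auto simp: deg_less_def coeff_eq_0)
  then show "a \<in> (\<lambda>r. monom 1 n + r) ` deg_less n"
    by (intro image_eqI[of _ _ "a - monom 1 n"]) auto
next
  fix a :: "'a poly" assume "a \<in> (\<lambda>r. monom 1 n + r) ` deg_less n"
  then obtain r where r: "a = monom 1 n + r" "r \<in> deg_less n" by auto
  have "degree a \<le> n" using r by (intro degree_le) (auto simp: deg_less_def)
  moreover have "coeff a n = 1" using r by (auto simp: deg_less_def)
  ultimately have "degree a = n" by (metis le_antisym le_degree zero_neq_one)
  then show "a \<in> {a. monic a \<and> degree a = n}" using \<open>coeff a n = 1\<close> by auto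
qed

lemma finite_monic_degree [simp, intro]:
  "finite {a::'a::{comm_ring_1,finite} poly. monic a \<and> degree a = n}"
  by (simp add: monic_degree_eq_image)

lemma card_monic_degree: "card {a::'a::{comm_ring_1,finite} poly. monic a \<and> degree a = n} = CARD('a) ^ n"
  by (simp add: monic_degree_eq_image card_image card_deg_less)

section \<open>Sums over residue systems\<close>

lemma mod_in_deg_less: "N \<noteq> 0 \<Longrightarrow> (x::'a::field poly) mod N \<in> deg_less (degree N)"
  using degree_mod_less[of N x] by (auto simp: deg_less_iff)

lemma mod_deg_less: "r \<in> deg_less (degree N) \<Longrightarrow> (r::'a::field poly) mod N = r"
  by (auto simp: deg_less_iff mod_poly_less)

lemma sum_deg_less_shift:
  fixes N :: "'a::{field,finite} poly" and f :: "'a poly \<Rightarrow> 'b::comm_monoid_add"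
  assumes "N \<noteq> 0" and per: "\<And>x. f (x mod N) = f x"
  shows "(\<Sum>r\<in>deg_less (degree N). f (c + r)) = (\<Sum>r\<in>deg_less (degree N). f r)"
proof (rule sum.reindex_bij_witness[of _ "\<lambda>r. (r - c) mod N" "\<lambda>r. (c + r) mod N"])
  fix a :: "'a poly" assume a: "a \<in> deg_less (degree N)"
  show "((c + a) mod N - c) mod N = a" "(c + (a - c) mod N) mod N = a"
    using mod_deg_less[OF a] by (simp_all add: mod_simps)
qed (use assms in \<open>auto simp: mod_in_deg_less\<close>)

text \<open>Division with remainder cuts \<open>deg_less n\<close> into
  \<open>q ^ (n - degree N)\<close> complete residue systems. The shift \<open>c\<close> is there
  for monic polynomials, which are the translates \<open>monom 1 n + x\<close>.\<close>

lemma sum_deg_less_periodic: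
  fixes N :: "'a::{field,finite} poly" and f :: "'a poly \<Rightarrow> 'b::comm_semiring_1"
  assumes "N \<noteq> 0" "degree N \<le> n" and per: "\<And>x. f (x mod N) = f x"
  shows "(\<Sum>x\<in>deg_less n. f (c + x)) =
    of_nat CARD('a) ^ (n - degree N) * (\<Sum>r\<in>deg_less (degree N). f r)"
proof -
  let ?K = "deg_less (n - degree N) :: 'a poly set" and ?R = "deg_less (degree N) :: 'a poly set"
  have deg: "k * N + r \<in> deg_less n" if "k \<in> ?K" "r \<in> ?R" for k r
  proof (intro deg_less_add)
    show "k * N \<in> deg_less n"
      using that assms(1,2) by (cases "k = 0") (auto simp: deg_less_iff degree_mult_eq)
    show "r \<in> deg_less n" using that deg_less_mono[OF assms(2)] by auto
  qed
  have div: "x div N \<in> ?K" if "x \<in> deg_less n" for x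
  proof (cases "x div N = 0")
    case False
    have "x div N * N = x - x mod N" by (simp add: minus_mod_eq_div_mult)
    also have "\<dots> \<in> deg_less n"
      using that mod_in_deg_less[OF assms(1)] deg_less_mono[OF assms(2)] by (intro deg_less_diff) auto
    finally show ?thesis using False assms(1,2) by (auto simp: deg_less_iff degree_mult_eq)
  qed auto
  have dm: "(k * N + r) div N = k" "(k * N + r) mod N = r" if "r \<in> ?R" for k r
    using that mod_deg_less[OF that] \<open>N \<noteq> 0\<close> by (auto simp: deg_less_iff div_poly_less)
  have "(\<Sum>x\<in>deg_less n. f (c + x)) = (\<Sum>(k, r)\<in>?K \<times> ?R. f (c + (k * N + r)))"
    by (rule sum.reindex_bij_witness[of _ "\<lambda>(k, r). k * N + r" "\<lambda>x. (x div N, x mod N)"])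
      (use assms in \<open>auto simp: deg div dm mod_in_deg_less simp del: div_mult_self1 div_mult_self2 div_mult_self3 div_mult_self4 mod_mult_self1 mod_mult_self2 mod_mult_self3 mod_mult_self4\<close>)
  also have "\<dots> = (\<Sum>k\<in>?K. \<Sum>r\<in>?R. f (c + (k * N + r)))"
    by (simp add: sum.cartesian_product)
  also have "\<dots> = (\<Sum>k\<in>?K. \<Sum>r\<in>?R. f r)"
  proof (rule sum.cong[OF refl])
    fix k
    show "(\<Sum>r\<in>?R. f (c + (k * N + r))) = (\<Sum>r\<in>?R. f r)"
      using sum_deg_less_shift[of N f "c + k * N"] assms by (simp add: add.assoc)
  qed
  finally show ?thesis by (simp add: card_deg_less)
qed

section \<open>Bezout's identity, coprimality and Chinese remainders\<close>

text \<open>A nonzero combination \<open>g\<close> of least degree divides every combination, since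
  remainders modulo \<open>g\<close> are again combinations; so \<open>g\<close> is a common
  divisor, hence a unit.\<close>

lemma bezout_poly:
  fixes a b :: "'a::field poly"
  assumes "coprime a b"
  obtains x y where "x * a + y * b = 1"
proof -
  define I where "I = {x * a + y * b | x y. True}"
  have "a \<noteq> 0 \<or> b \<noteq> 0" using assms by auto
  moreover have "a \<in> I" "b \<in> I"
    unfolding I_def by (auto intro: exI[of _ 1] exI[of _ 0])
  ultimately have "\<exists>g. g \<in> I \<and> g \<noteq> 0" by auto
  then obtain g where g: "g \<in> I" "g \<noteq> 0" and min: "\<And>g'. g' \<in> I \<Longrightarrow> g' \<noteq> 0 \<Longrightarrow> degree g \<le> degree g'"
    using exists_least_iff[of "\<lambda>n. \<exists>g. g \<in> I \<and> g \<noteq> 0 \<and> degree g = n"]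
    by (metis linorder_le_less_linear)
  obtain x0 y0 where xy: "g = x0 * a + y0 * b" using g by (auto simp: I_def)
  have dvd: "g dvd z" if "z \<in> I" for z
  proof -
    from that obtain x y where z: "z = x * a + y * b" unfolding I_def by blast
    have "z mod g = (x - (z div g) * x0) * a + (y - (z div g) * y0) * b"
      using div_mult_mod_eq[of z g] by (subst (asm) (2) xy) (simp add: z xy algebra_simps)
    then have "z mod g \<in> I" by (auto simp: I_def)
    then have "z mod g = 0"
      using min[of "z mod g"] degree_mod_less[OF g(2), of z] by (meson not_le)
    then show ?thesis by auto
  qed
  have "is_unit g" using assms dvd \<open>a \<in> I\<close> \<open>b \<in> I\<close> by (auto simp: coprime_def)
  then obtain h where "1 = g * h" by (rule dvdE)
  then have "(h * x0) * a + (h * y0) * b = 1" by (simp add: xy algebra_simps)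
  then show ?thesis by (rule that)
qed

lemma coprime_poly_iff_bezout:
  "coprime (a::'a::field poly) b \<longleftrightarrow> (\<exists>x y. x * a + y * b = 1)"
proof
  assume "\<exists>x y. x * a + y * b = 1"
  then show "coprime a b" by (metis coprime_def dvd_add dvd_mult)
qed (metis bezout_poly)

lemma coprime_poly_mult_right_iff:
  "coprime (a::'a::field poly) (b * c) \<longleftrightarrow> coprime a b \<and> coprime a c"
proof safe
  assume "coprime a b" "coprime a c"
  then obtain x y u v where xy: "x * a + y * b = 1" and uv: "u * a + v * c = 1"
    by (metis bezout_poly)
  have "(x * a + y * b) * (u * a + v * c) = 1" using xy uv by simp
  then have "(x * u * a + x * v * c + y * b * u) * a + (y * v) * (b * c) = 1"
    by (simp add: algebra_simps)
  then show "coprime a (b * c)" unfolding coprime_poly_iff_bezout by blast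
qed (auto simp: coprime_def)

lemma coprime_poly_mult_left_iff:
  "coprime (b * c) (a::'a::field poly) \<longleftrightarrow> coprime b a \<and> coprime c a"
  by (simp add: coprime_poly_mult_right_iff coprime_commute)

lemma coprime_poly_dvd_mult:
  "coprime (a::'a::field poly) b \<Longrightarrow> a dvd b * c \<Longrightarrow> a dvd c"
proof -
  assume "coprime a b" and d: "a dvd b * c"
  then obtain x y where "x * a + y * b = 1" by (metis bezout_poly)
  then have "c = (x * a + y * b) * c" by simp
  also have "\<dots> = x * c * a + y * (b * c)" by (simp add: algebra_simps)
  finally have "c = x * c * a + y * (b * c)" .
  then show "a dvd c" by (metis d dvd_add dvd_mult dvd_triv_right)
qed

lemma coprime_poly_mult_dvd:
  assumes "coprime (a::'a::field poly) b" "a dvd c" "b dvd c" shows "a * b dvd c"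
proof -
  obtain k where k: "c = b * k" using assms(3) by auto
  then have "a dvd k" using coprime_poly_dvd_mult assms by blast
  then show ?thesis by (auto simp: k mult.commute)
qed

lemma coprime_poly_cong:
  "N dvd (x::'a::field poly) - y \<Longrightarrow> coprime x N \<longleftrightarrow> coprime y N"
proof -
  assume N: "N dvd x - y"
  have "c dvd x \<longleftrightarrow> c dvd y" if "c dvd N" for c
  proof -
    have "c dvd x - y" using that N by (rule dvd_trans)
    then have "c dvd (x - y) + y \<longleftrightarrow> c dvd y" by (rule dvd_add_right_iff)
    then show ?thesis by simp
  qed
  then show ?thesis unfolding coprime_def by auto
qed

lemma coprime_poly_mod [simp]: "coprime ((x::'a::field poly) mod N) N \<longleftrightarrow> coprime x N"
  by (intro coprime_poly_cong) (metis mod_eq_dvd_iff mod_mod_trivial)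

lemma chinese_remainder_poly:
  assumes "coprime (a::'a::field poly) b"
  obtains z where "a dvd z - u" "b dvd z - v"
proof -
  obtain x y where xy: "x * a + y * b = 1" using assms by (metis bezout_poly)
  define z where "z = u * (y * b) + v * (x * a)"
  have 1: "y * b = 1 - x * a" "x * a = 1 - y * b" using xy by (auto simp: algebra_simps)
  have "z - u = a * (x * (v - u))" unfolding z_def 1(1) by (simp add: algebra_simps)
  moreover have "z - v = b * (y * (u - v))" unfolding z_def 1(2) by (simp add: algebra_simps)
  ultimately show ?thesis by (intro that[of z]) simp_all
qed

section \<open>Monic polynomials and irreducible factors\<close>

lemma is_unit_poly_iff_degree:
  "is_unit (p::'a::field poly) \<longleftrightarrow> p \<noteq> 0 \<and> degree p = 0"
  by (metis is_unit_iff_degree not_is_unit_0)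

lemma monic_nonzero: "monic (p::'a::comm_semiring_1 poly) \<Longrightarrow> p \<noteq> 0"
  by auto

lemma monic_mult: "monic (p::'a::idom poly) \<Longrightarrow> monic r \<Longrightarrow> monic (p * r)"
  by (simp add: lead_coeff_mult)

lemma monic_mult_cancel: "monic (p::'a::idom poly) \<Longrightarrow> monic (p * r) \<Longrightarrow> monic r"
  by (simp add: lead_coeff_mult)

lemma monic_power: "monic (p::'a::idom poly) \<Longrightarrow> monic (p ^ n)"
  by (simp add: lead_coeff_power)

lemma monic_unit: "monic (p::'a::field poly) \<Longrightarrow> is_unit p \<Longrightarrow> p = 1"
  by (metis degree_0_id is_unit_poly_iff_degree one_pCons)

lemma monic_dvd_antisym:
  assumes "monic (p::'a::field poly)" "monic r" "p dvd r" "r dvd p" shows "p = r"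
proof -
  obtain k where k: "r = p * k" using assms(3) by auto
  obtain j where j: "p = r * j" using assms(4) by auto
  have "p * (k * j) = p * 1" by (metis j k mult.assoc mult.right_neutral)
  then have "k * j = 1" using monic_nonzero[OF assms(1)] by (metis mult_cancel_left)
  then have "is_unit k" by (metis dvd_triv_left)
  moreover have "monic k" using assms k monic_mult_cancel by blast
  ultimately have "k = 1" by (rule monic_unit[rotated])
  then show ?thesis using k by simp
qed

lemma exists_monic_irreducible_dvd:
  assumes "(a::'a::field poly) \<noteq> 0" "degree a > 0"
  obtains p where "monic p" "irreducible p" "p dvd a"
proof -
  have "\<exists>p. monic p \<and> irreducible p \<and> p dvd a"
    using assms
  proof (induction "degree a" arbitrary: a rule: less_induct)
    case less
    show ?case
    proof (cases "irreducible a")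
      case True
      let ?p = "smult (inverse (lead_coeff a)) a"
      have "a = [:lead_coeff a:] * ?p" "is_unit [:lead_coeff a:]" using less.prems
        by (auto simp: is_unit_pCons_iff)
      then have "irreducible ?p" using True by (metis irreducible_mult_unit_left)
      moreover have "?p dvd a" using less.prems by (simp add: smult_dvd_iff)
      moreover have "monic ?p" using less.prems by simp
      ultimately show ?thesis by blast
    next
      case False
      then obtain x y where xy: "a = x * y" "\<not> is_unit x" "\<not> is_unit y"
        using less.prems by (auto simp: irreducible_def is_unit_poly_iff_degree)
      then have "x \<noteq> 0" "y \<noteq> 0" "degree x > 0" "degree y > 0" using less.prems
        by (auto simp: is_unit_poly_iff_degree)
      then show ?thesis using less.hyps[of x] xy by (auto simp: degree_mult_eq)
    qed
  qed
  then show ?thesis using that by blast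
qed

lemma irreducible_imp_coprime_poly:
  "irreducible (p::'a::field poly) \<Longrightarrow> \<not> p dvd a \<Longrightarrow> coprime p a"
  by (meson coprimeI dvd_trans irreducibleD')

lemma irreducible_degree_pos: "irreducible (p::'a::field poly) \<Longrightarrow> degree p > 0"
  using irreducible_not_unit[of p] by (auto simp: is_unit_poly_iff_degree intro!: gr0I)

lemma irreducible_dvd_mult_iff:
  "irreducible (p::'a::field poly) \<Longrightarrow> p dvd a * b \<longleftrightarrow> p dvd a \<or> p dvd b"
  by (meson field_poly_irreducible_imp_prime prime_elem_dvd_mult_iff)

lemma irreducible_dvd_power:
  "irreducible (p::'a::field poly) \<Longrightarrow> p dvd a ^ n \<Longrightarrow> p dvd a"
  by (meson field_poly_irreducible_imp_prime prime_elem_dvd_power)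

lemma monic_irreducible_dvd_eq:
  "monic (p::'a::field poly) \<Longrightarrow> irreducible p \<Longrightarrow> monic r \<Longrightarrow> irreducible r \<Longrightarrow> p dvd r \<Longrightarrow> p = r"
  using irreducibleD'[of r p] irreducible_not_unit[of p] monic_dvd_antisym[of p r] by blast

lemma coprime_poly_iff_no_common_irreducible:
  assumes "(a::'a::field poly) \<noteq> 0 \<or> b \<noteq> 0"
  shows "coprime a b \<longleftrightarrow> (\<forall>p. monic p \<and> irreducible p \<longrightarrow> \<not> (p dvd a \<and> p dvd b))"
proof
  assume *: "\<forall>p. monic p \<and> irreducible p \<longrightarrow> \<not> (p dvd a \<and> p dvd b)"
  show "coprime a b"
  proof (rule coprimeI)
    fix c assume c: "c dvd a" "c dvd b"
    then have "c \<noteq> 0" using assms by auto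
    then show "is_unit c"
      using exists_monic_irreducible_dvd[of c] * c by (metis dvd_trans gr0I is_unit_poly_iff_degree)
  qed
qed (metis coprime_def irreducible_not_unit)

lemma monic_prime_induct [consumes 1, case_names one prime]:
  fixes a :: "'a::field poly"
  assumes "monic a" "P 1"
    and step: "\<And>p a. monic p \<Longrightarrow> irreducible p \<Longrightarrow> monic a \<Longrightarrow> P a \<Longrightarrow> P (p * a)"
  shows "P a"
  using assms(1)
proof (induction "degree a" arbitrary: a rule: less_induct)
  case less
  show ?case
  proof (cases "degree a = 0")
    case True
    then have "a = 1" using less.prems monic_unit[of a] monic_nonzero[of a] by (simp add: is_unit_poly_iff_degree)
    then show ?thesis using assms(2) by simp
  next
    case False
    then obtain p where p: "monic p" "irreducible p" "p dvd a"
      using less.prems by (metis exists_monic_irreducible_dvd gr0I monic_nonzero)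
    then obtain b where b: "a = p * b" by auto
    have "monic b" "b \<noteq> 0" using b p less.prems monic_mult_cancel by auto
    moreover have "degree b < degree a"
      using b p irreducible_degree_pos[of p] \<open>b \<noteq> 0\<close> monic_nonzero[OF p(1)] by (simp add: degree_mult_eq)
    ultimately show ?thesis using less.hyps[of b] step p b by auto
  qed
qed

section \<open>A Polya-Vinogradov bound for real characters\<close>

text \<open>Euler's totient. For a nonzero constant \<open>N\<close> the only residue is
  \<open>0\<close>, which is coprime to \<open>N\<close>, so the value is 1.\<close>

definition phi_poly :: "'a::{field,finite} poly \<Rightarrow> nat"
  where "phi_poly N = card {x \<in> deg_less (degree N). coprime x N}"

text \<open>The fibres of a nonzero functional are translates of its kernel by multiples of
  \<open>w\<close>, so the \<open>q\<close> fibres have equal size.\<close>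

lemma card_deg_less_functional:
  fixes f :: "'a::{field,finite} poly \<Rightarrow> 'a"
  assumes add: "\<And>x y. f (x + y) = f x + f y" and smult: "\<And>c x. f (smult c x) = c * f x"
    and w: "w \<in> deg_less k" "f w \<noteq> 0"
  shows "CARD('a) * card {y \<in> deg_less k. f y = 0} = CARD('a) ^ k"
proof -
  have fib: "card {y \<in> deg_less k. f y = c} = card {y \<in> deg_less k. f y = 0}" for c
  proof (rule bij_betw_same_card)
    let ?s = "smult (c / f w) w"
    have s: "?s \<in> deg_less k" "f ?s = c" using w by (auto simp: smult intro: deg_less_smult)
    have "f y = f (y - ?s) + c" for y using add[of "y - ?s" ?s] s by simp
    then have "f (y - ?s) = f y - c" for y by (metis add_diff_cancel_right')
    then show "bij_betw (\<lambda>y. y - ?s) {y \<in> deg_less k. f y = c} {y \<in> deg_less k. f y = 0}"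
      using s by (intro bij_betwI[of _ _ _ "\<lambda>y. y + ?s"])
        (auto simp: add intro: deg_less_add deg_less_diff)
  qed
  have "CARD('a) ^ k = card (\<Union>c. {y \<in> deg_less k. f y = c})"
    by (simp flip: card_deg_less) (auto intro!: arg_cong[where f = card])
  also have "\<dots> = (\<Sum>c\<in>UNIV. card {y \<in> deg_less k. f y = c})"
    by (rule card_UN_disjoint) auto
  also have "\<dots> = (\<Sum>c\<in>(UNIV::'a set). card {y \<in> deg_less k. f y = 0})"
    by (intro sum.cong refl fib)
  finally show ?thesis by simp
qed

declare sum_mult_of_bool_eq [simp del] sum_of_bool_mult_eq [simp del] sum_of_bool_eq [simp del]

text \<open>Quadratic characters modulo \<open>N\<close>, primitive or not. On units the values are
  \<open>1\<close> and \<open>-1\<close>, so nontriviality means that \<open>-1\<close> is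
  attained.\<close>

locale real_character =
  fixes N :: "'a::{field,finite} poly" and \<psi> :: "'a poly \<Rightarrow> real"
  assumes degree_N: "degree N > 0"
    and mult: "\<psi> (x * y) = \<psi> x * \<psi> y"
    and per: "\<psi> (x mod N) = \<psi> x"
    and eq_0: "\<not> coprime x N \<Longrightarrow> \<psi> x = 0"
    and abs_eq_1: "coprime x N \<Longrightarrow> \<bar>\<psi> x\<bar> = 1"
    and nontrivial: "\<exists>u. \<psi> u = - 1"
begin

abbreviation "n \<equiv> degree N"
abbreviation R :: "'a poly set" where "R \<equiv> deg_less n"

lemma card_gt_1: "real CARD('a) > 1"
  using CARD_field_gt_1[where 'a='a] by simp

lemma N_nonzero: "N \<noteq> 0"
  using degree_N by auto

lemma zero_eq_0 [simp]: "\<psi> 0 = 0"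
  using degree_N by (intro eq_0) (auto simp: is_unit_poly_iff_degree)

lemma abs_le_1: "\<bar>\<psi> x\<bar> \<le> 1"
  using eq_0[of x] abs_eq_1[of x] by (cases "coprime x N") auto

lemma sum_unit_mult:
  assumes "coprime u N" and f: "\<And>x. f (x mod N) = f x"
  shows "(\<Sum>x\<in>R. f (u * x)) = (\<Sum>x\<in>R. f x :: 'b::comm_monoid_add)"
proof -
  obtain v w where vw: "v * u + w * N = 1" using assms(1) by (metis bezout_poly)
  have 1: "v * u = 1 - w * N" using vw by (simp add: algebra_simps)
  have 2: "(v * (u * x)) mod N = x mod N" for x
  proof -
    have "v * (u * x) = x + N * (- w * x)"
      unfolding mult.assoc[symmetric] 1 by (simp add: algebra_simps)
    then show ?thesis by (simp only: mod_mult_self2)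
  qed
  show ?thesis
  proof (rule sum.reindex_bij_witness[of _ "\<lambda>x. (v * x) mod N" "\<lambda>x. (u * x) mod N"])
    fix a assume a: "a \<in> R"
    show "(v * ((u * a) mod N)) mod N = a" "(u * ((v * a) mod N)) mod N = a"
      using 2[of a] mod_deg_less[OF a] by (simp_all add: mod_simps mult.left_commute)
  qed (auto simp: f mod_in_deg_less N_nonzero)
qed

lemma sum_residues: "(\<Sum>x\<in>R. \<psi> x) = 0"
proof -
  obtain u where u: "\<psi> u = - 1" using nontrivial by auto
  then have "coprime u N" using eq_0 by fastforce
  then have "(\<Sum>x\<in>R. \<psi> (u * x)) = (\<Sum>x\<in>R. \<psi> x)" by (intro sum_unit_mult per)
  then show ?thesis by (simp add: mult u sum_negf)
qed

text \<open>The range is a union of complete residue systems. With \<open>c = monom 1 k\<close> it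
  covers the monic polynomials of degree \<open>k\<close>, which later truncates the
  \<open>L\<close>-series.\<close>

lemma sum_deg_less_eq_0: "n \<le> k \<Longrightarrow> (\<Sum>x\<in>deg_less k. \<psi> (c + x)) = 0"
  by (subst sum_deg_less_periodic[of N]) (auto simp: per sum_residues N_nonzero)

section \<open>Duality on residues and Gauss sums\<close>

text \<open>Up to the leading coefficient of \<open>N\<close>, this is the coefficient of
  \<open>1 / t\<close> in the expansion of \<open>z / N\<close> at infinity.\<close>

definition lam :: "'a poly \<Rightarrow> 'a" where "lam z = coeff (z mod N) (n - 1)"

lemma lam_add: "lam (x + y) = lam x + lam y"
  and lam_smult: "lam (smult c x) = c * lam x"
  and lam_0 [simp]: "lam 0 = 0"
  by (simp_all add: lam_def poly_mod_add_left mod_smult_left)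

lemma lam_mod_left: "lam ((x mod N) * y) = lam (x * y)"
  and lam_mod_right: "lam (x * (y mod N)) = lam (x * y)"
  by (simp_all add: lam_def mod_simps)

text \<open>The product has degree at most \<open>(l - 1) + (n - l - 1) = n - 2\<close>: no
  reduction modulo \<open>N\<close> takes place and position \<open>n - 1\<close> is empty. With
  \<open>lam_nonzero\<close>, \<open>deg_less l\<close> and \<open>deg_less (n - l)\<close> are
  orthogonal complements under \<open>lam (x * y)\<close>.\<close>

lemma lam_eq_0:
  assumes "x \<in> deg_less l" "y \<in> deg_less (n - l)" shows "lam (x * y) = 0"
proof (cases "x = 0 \<or> y = 0")
  case False
  then have "degree x < l" "degree y < n - l" using assms by (auto simp: deg_less_iff)
  then have "degree (x * y) < n - 1" using False by (simp add: degree_mult_eq)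
  then show ?thesis by (simp add: lam_def mod_poly_less coeff_eq_0)
qed auto

text \<open>A monomial moves the leading coefficient of \<open>x\<close> exactly to position
  \<open>n - 1\<close>, still below the degree of \<open>N\<close>.\<close>

lemma lam_nonzero:
  assumes "x \<in> R" "x \<notin> deg_less l" shows "\<exists>y\<in>deg_less (n - l). lam (x * y) \<noteq> 0"
proof (rule bexI)
  let ?j = "n - 1 - degree x"
  have x: "x \<noteq> 0" "degree x < n" "degree x \<ge> l" using assms by (auto simp: deg_less_iff)
  have "?j < n - l" using x by linarith
  then show "monom 1 ?j \<in> deg_less (n - l)" by (auto simp: deg_less_def coeff_monom)
  have d: "degree (x * monom 1 ?j) = n - 1" using x by (simp add: degree_mult_eq degree_monom_eq)
  then have "(x * monom 1 ?j) mod N = x * monom 1 ?j" using degree_N by (intro mod_poly_less) simp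
  moreover have "x * monom 1 ?j \<noteq> 0" using x by simp
  ultimately show "lam (x * monom 1 ?j) \<noteq> 0" using d unfolding lam_def by (metis leading_coeff_0_iff)
qed

text \<open>Stands in for the orthogonality of additive characters: the functional given by
  \<open>x\<close> is zero on \<open>deg_less (n - l)\<close> for \<open>x\<close> in
  \<open>deg_less l\<close>, and otherwise its kernel is a hyperplane.\<close>

lemma card_lam_kernel:
  assumes "x \<in> R"
  shows "real CARD('a) * real (card {y \<in> deg_less (n - l). lam (x * y) = 0}) =
    real CARD('a) ^ (n - l) * (1 + (real CARD('a) - 1) * of_bool (x \<in> deg_less l))"
proof (cases "x \<in> deg_less l")
  case True
  then have "{y \<in> deg_less (n - l). lam (x * y) = 0} = deg_less (n - l)" using lam_eq_0 by auto
  then show ?thesis using True by (simp add: card_deg_less)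
next
  case False
  with lam_nonzero assms obtain w where "w \<in> deg_less (n - l)" "lam (x * w) \<noteq> 0" by blast
  then have "CARD('a) * card {y \<in> deg_less (n - l). lam (x * y) = 0} = CARD('a) ^ (n - l)"
    by (intro card_deg_less_functional) (auto simp: distrib_left lam_add lam_smult)
  then have "real (CARD('a) * card {y \<in> deg_less (n - l). lam (x * y) = 0}) = real (CARD('a) ^ (n - l))"
    by (rule arg_cong)
  then show ?thesis using False by simp
qed

text \<open>The average over the scalars \<open>c\<close> of the Gauss sums of \<open>\<psi>\<close>
  at \<open>c y\<close>: averaging a nontrivial additive character over all multiples leaves the
  indicator of \<open>lam = 0\<close>.\<close>

definition G :: "'a poly \<Rightarrow> real" where "G y = (\<Sum>x\<in>R. \<psi> x * of_bool (lam (x * y) = 0))"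

lemma G_mod: "G (y mod N) = G y"
  by (simp add: G_def lam_mod_right)

text \<open>Substituting \<open>u x\<close> for \<open>x\<close> moves the unit out of the kernel
  and into \<open>\<psi>\<close>, at the cost of a sign; hence the squares.\<close>

lemma G_unit_mult:
  assumes "coprime u N" shows "(G (u * y))\<^sup>2 = (G y)\<^sup>2"
proof -
  have "\<psi> u * G (u * y) = (\<Sum>x\<in>R. \<psi> (u * x) * of_bool (lam ((u * x) * y) = 0))"
    by (simp add: G_def mult sum_distrib_left mult_ac)
  also have "\<dots> = (\<Sum>x\<in>R. \<psi> x * of_bool (lam (x * y) = 0))"
    using assms by (intro sum_unit_mult) (simp_all add: per lam_mod_left)
  finally have "G y = \<psi> u * G (u * y)" by (simp add: G_def)
  then have "(G y)\<^sup>2 = \<bar>\<psi> u\<bar>\<^sup>2 * (G (u * y))\<^sup>2" by (simp add: power_mult_distrib)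
  then show ?thesis using abs_eq_1[OF assms] by simp
qed

text \<open>Poisson summation: by \<open>card_lam_kernel\<close> the sum over the dual space detects
  \<open>deg_less l\<close>, and the constant part of the count drops out because
  \<open>\<psi>\<close> sums to zero over the residues.\<close>

lemma sum_G:
  "real CARD('a) * (\<Sum>y\<in>deg_less (n - l). G y) = (real CARD('a) - 1) * real CARD('a) ^ (n - l) * (\<Sum>x\<in>R. \<psi> x * of_bool (x \<in> deg_less l))"
proof -
  have "(\<Sum>y\<in>deg_less (n - l). G y) = (\<Sum>x\<in>R. \<Sum>y\<in>deg_less (n - l). \<psi> x * of_bool (lam (x * y) = 0))"
    unfolding G_def by (rule sum.swap)
  also have "\<dots> = (\<Sum>x\<in>R. \<psi> x * real (card {y \<in> deg_less (n - l). lam (x * y) = 0}))"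
    by (simp add: sum_distrib_left[symmetric] sum_of_bool_eq Int_def)
  finally have "real CARD('a) * (\<Sum>y\<in>deg_less (n - l). G y) =
      (\<Sum>x\<in>R. \<psi> x * (real CARD('a) * real (card {y \<in> deg_less (n - l). lam (x * y) = 0})))"
    by (simp add: sum_distrib_left mult_ac)
  also have "\<dots> = (\<Sum>x\<in>R. \<psi> x * (real CARD('a) ^ (n - l) * (1 + (real CARD('a) - 1) * of_bool (x \<in> deg_less l))))"
    by (intro sum.cong refl) (simp add: card_lam_kernel)
  also have "\<dots> = real CARD('a) ^ (n - l) * (\<Sum>x\<in>R. \<psi> x) +
      (real CARD('a) - 1) * real CARD('a) ^ (n - l) * (\<Sum>x\<in>R. \<psi> x * of_bool (x \<in> deg_less l))"
    unfolding sum_distrib_left sum.distrib[symmetric] by (intro sum.cong refl) (simp add: algebra_simps)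
  finally show ?thesis by (simp add: sum_residues)
qed

text \<open>For \<open>v \<noteq> 0\<close> the sum over \<open>c\<close> below counts one solution, which turns the joint kernel
  of two functionals into kernels of single functionals.\<close>

lemma of_bool_both_zero:
  fixes u v :: 'a
  shows "real CARD('a) * (of_bool (u = 0) * of_bool (v = 0)) =
    (\<Sum>c\<in>UNIV. of_bool (u + c * v = 0)) - 1 + of_bool (v = 0)"
proof (cases "v = 0")
  case False
  then have "{c. u + c * v = 0} = {- u / v}" by (auto simp: field_simps add_eq_0_iff2)
  then show ?thesis using False by (simp add: of_bool_def sum.If_cases)
qed (auto simp: of_bool_def)

lemma sum_of_bool_lam:
  assumes "z \<in> R"
  shows "real CARD('a) * (\<Sum>y\<in>R. of_bool (lam (z * y) = 0)) = real CARD('a) ^ n * (1 + (real CARD('a) - 1) * of_bool (z = 0))"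
  using card_lam_kernel[OF assms, of 0] by (simp add: deg_less_0 sum_of_bool_eq Int_def)

text \<open>The functionals of \<open>x\<close> and \<open>x'\<close> are proportional iff
  \<open>x\<close> is a multiple of \<open>x'\<close>. As \<open>x' \<noteq> 0\<close>, at most one
  \<open>c\<close> contributes, so the sum over \<open>c\<close> is the indicator of this case, in
  which the joint kernel is larger by a factor \<open>q\<close>.\<close>

lemma sum_of_bool_lam_pair:
  assumes "x \<in> R" "x' \<in> R" "x' \<noteq> 0"
  shows "(real CARD('a))\<^sup>2 * (\<Sum>y\<in>R. of_bool (lam (x * y) = 0) * of_bool (lam (x' * y) = 0)) =
    real CARD('a) ^ n * (1 + (real CARD('a) - 1) * (\<Sum>c\<in>UNIV. of_bool (x = smult c x')))"
proof -
  have "(real CARD('a))\<^sup>2 * (\<Sum>y\<in>R. of_bool (lam (x * y) = 0) * of_bool (lam (x' * y) = 0)) =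
      real CARD('a) * (\<Sum>y\<in>R. real CARD('a) * (of_bool (lam (x * y) = 0) * of_bool (lam (x' * y) = 0)))"
    by (simp add: power2_eq_square sum_distrib_left mult_ac)
  also have "\<dots> = real CARD('a) * (\<Sum>y\<in>R. (\<Sum>c\<in>UNIV. of_bool (lam ((x + smult c x') * y) = 0)) - 1
      + of_bool (lam (x' * y) = 0))"
    by (simp add: of_bool_both_zero distrib_right lam_add lam_smult)
  also have "\<dots> = (\<Sum>c\<in>UNIV. real CARD('a) * (\<Sum>y\<in>R. of_bool (lam ((x + smult c x') * y) = 0)))
      - real CARD('a) * real CARD('a) ^ n + real CARD('a) * (\<Sum>y\<in>R. of_bool (lam (x' * y) = 0))"
    by (subst sum.distrib, subst sum_subtractf, subst sum.swap)
      (simp add: card_deg_less sum_distrib_left algebra_simps)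
  also have "\<dots> = (\<Sum>c\<in>UNIV. real CARD('a) ^ n * (1 + (real CARD('a) - 1) * of_bool (x + smult c x' = 0)))
      - real CARD('a) * real CARD('a) ^ n + real CARD('a) ^ n"
    using assms by (simp add: sum_of_bool_lam deg_less_add deg_less_smult)
  also have "\<dots> = real CARD('a) ^ n * (1 + (real CARD('a) - 1) * (\<Sum>c\<in>UNIV. of_bool (x + smult c x' = 0)))"
    by (simp add: sum.distrib distrib_left mult.assoc flip: sum_distrib_left)
  also have "(\<Sum>c\<in>UNIV. of_bool (x + smult c x' = 0)) = (\<Sum>c\<in>UNIV. of_bool (x = smult c x') :: real)"
    by (rule sum.reindex_bij_witness[of _ uminus uminus]) (simp_all add: eq_neg_iff_add_eq_0)
  finally show ?thesis .
qed

text \<open>Parseval: after expanding the square, the part of the joint-kernel count that is the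
  same for all pairs carries the square of the sum of \<open>\<psi>\<close>, which is 0. Only
  proportional pairs remain, at most \<open>q * phi_poly N\<close> nonzero terms of absolute value
  1.\<close>

lemma sum_G_square: "(\<Sum>y\<in>R. (G y)\<^sup>2) \<le> real CARD('a) ^ n * real (phi_poly N)"
proof -
  have "(real CARD('a))\<^sup>2 * (\<Sum>y\<in>R. (G y)\<^sup>2) = (real CARD('a))\<^sup>2 * (\<Sum>y\<in>R. \<Sum>x\<in>R. \<Sum>x'\<in>R.
      \<psi> x * \<psi> x' * (of_bool (lam (x * y) = 0) * of_bool (lam (x' * y) = 0)))"
    by (simp add: G_def power2_eq_square sum_product mult_ac)
  also have "\<dots> = (real CARD('a))\<^sup>2 * (\<Sum>x\<in>R. \<Sum>y\<in>R. \<Sum>x'\<in>R.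
      \<psi> x * \<psi> x' * (of_bool (lam (x * y) = 0) * of_bool (lam (x' * y) = 0)))"
    by (subst sum.swap) simp
  also have "\<dots> = (real CARD('a))\<^sup>2 * (\<Sum>x\<in>R. \<Sum>x'\<in>R. \<Sum>y\<in>R.
      \<psi> x * \<psi> x' * (of_bool (lam (x * y) = 0) * of_bool (lam (x' * y) = 0)))"
    by (subst (2) sum.swap) simp
  also have "\<dots> = (\<Sum>x\<in>R. \<Sum>x'\<in>R. \<psi> x * \<psi> x' *
      ((real CARD('a))\<^sup>2 * (\<Sum>y\<in>R. of_bool (lam (x * y) = 0) * of_bool (lam (x' * y) = 0))))"
    by (simp only: sum_distrib_left mult_ac)
  also have "\<dots> = (\<Sum>x\<in>R. \<Sum>x'\<in>R. \<psi> x * \<psi> x' *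
      (real CARD('a) ^ n * (1 + (real CARD('a) - 1) * (\<Sum>c\<in>UNIV. of_bool (x = smult c x')))))"
  proof (intro sum.cong refl)
    fix x x' assume *: "x \<in> R" "x' \<in> R"
    show "\<psi> x * \<psi> x' * ((real CARD('a))\<^sup>2 * (\<Sum>y\<in>R. of_bool (lam (x * y) = 0) * of_bool (lam (x' * y) = 0))) =
      \<psi> x * \<psi> x' * (real CARD('a) ^ n * (1 + (real CARD('a) - 1) * (\<Sum>c\<in>UNIV. of_bool (x = smult c x'))))"
    \<comment> \<open>The pair count is false for \<open>x' = 0\<close>, but there both sides vanish
      by \<open>\<psi> 0 = 0\<close>.\<close>
    proof (cases "x' = 0")
      case False
      then show ?thesis using * by (subst sum_of_bool_lam_pair) simp_all
    qed simp
  qed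
  also have "\<dots> = real CARD('a) ^ n * ((\<Sum>x\<in>R. \<psi> x) * (\<Sum>x\<in>R. \<psi> x)) +
      real CARD('a) ^ n * (real CARD('a) - 1) * (\<Sum>x\<in>R. \<Sum>x'\<in>R. \<Sum>c\<in>UNIV. \<psi> x * \<psi> x' * of_bool (x = smult c x'))"
    unfolding sum_product by (simp add: sum_distrib_left sum.distrib distrib_left mult_ac)
  also have "(\<Sum>x\<in>R. \<Sum>x'\<in>R. \<Sum>c\<in>UNIV. \<psi> x * \<psi> x' * of_bool (x = smult c x')) =
      (\<Sum>x'\<in>R. \<Sum>c\<in>UNIV. \<Sum>x\<in>R. \<psi> x * \<psi> x' * of_bool (x = smult c x'))"
    by (subst sum.swap, rule sum.cong[OF refl], rule sum.swap)
  also have "\<dots> = (\<Sum>x'\<in>R. \<Sum>c\<in>UNIV. \<psi> (smult c x') * \<psi> x')"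
  proof (intro sum.cong refl)
    fix x' :: "'a poly" and c assume "x' \<in> R"
    then have "R \<inter> {x. x = smult c x'} = {smult c x'}" by (auto simp: deg_less_smult)
    then show "(\<Sum>x\<in>R. \<psi> x * \<psi> x' * of_bool (x = smult c x')) = \<psi> (smult c x') * \<psi> x'"
      by (simp add: sum_mult_of_bool_eq)
  qed
  finally have eq: "(real CARD('a))\<^sup>2 * (\<Sum>y\<in>R. (G y)\<^sup>2) = real CARD('a) ^ n * (real CARD('a) - 1) * (\<Sum>x'\<in>R. \<Sum>c\<in>UNIV. \<psi> (smult c x') * \<psi> x')"
    by (simp add: sum_residues)
  have "(\<Sum>x'\<in>R. \<Sum>c\<in>UNIV. \<psi> (smult c x') * \<psi> x') \<le> (\<Sum>x'\<in>R. \<Sum>c\<in>(UNIV::'a set). of_bool (coprime x' N))"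
  proof (intro sum_mono)
    fix x' :: "'a poly" and c :: 'a
    have "\<psi> (smult c x') * \<psi> x' \<le> \<bar>\<psi> (smult c x')\<bar> * \<bar>\<psi> x'\<bar>" by (simp flip: abs_mult)
    also have "\<dots> \<le> 1 * of_bool (coprime x' N)"
      using abs_le_1 eq_0[of x'] abs_eq_1[of x'] by (intro mult_mono) auto
    finally show "\<psi> (smult c x') * \<psi> x' \<le> of_bool (coprime x' N)" by simp
  qed
  also have "\<dots> = real CARD('a) * real (phi_poly N)"
    by (simp add: phi_poly_def sum_of_bool_eq Int_def sum_distrib_left[symmetric])
  finally have "(real CARD('a))\<^sup>2 * (\<Sum>y\<in>R. (G y)\<^sup>2) \<le> real CARD('a) ^ n * (real CARD('a) - 1) * (real CARD('a) * real (phi_poly N))"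
    unfolding eq using card_gt_1 by (intro mult_left_mono) auto
  also have "\<dots> \<le> real CARD('a) ^ n * real CARD('a) * (real CARD('a) * real (phi_poly N))"
    by (intro mult_right_mono mult_left_mono) auto
  also have "\<dots> = (real CARD('a))\<^sup>2 * (real CARD('a) ^ n * real (phi_poly N))" by (simp add: power2_eq_square)
  finally show ?thesis using card_gt_1 by simp
qed

lemma phi_poly_pos: "phi_poly N > 0"
proof -
  have "1 \<in> {x \<in> R. coprime x N}" using degree_N by (simp add: deg_less_iff)
  then show ?thesis unfolding phi_poly_def by (subst card_gt_0_iff) auto
qed

text \<open>The unit multiples of \<open>y\<close> all give the same value of \<open>G\<^sup>2\<close>, so the mean square of \<open>G\<close>
  controls each single value, up to the number of times a residue can occur among them.\<close>

lemma G_square_le: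
  assumes "y \<in> deg_less e" shows "(G y)\<^sup>2 \<le> real CARD('a) ^ (n + e)"
proof (cases "y = 0")
  case True
  then show ?thesis by (simp add: G_def sum_residues)
next
  case False
  with assms have e: "degree y < e" by (auto simp: deg_less_iff)
  let ?U = "{u \<in> R. coprime u N}"
  have "real (phi_poly N) * (G y)\<^sup>2 = (\<Sum>u\<in>?U. (G (u * y))\<^sup>2)"
    by (simp add: G_unit_mult phi_poly_def)
  also have "\<dots> \<le> (\<Sum>u\<in>R. (G (u * y))\<^sup>2)" by (intro sum_mono2) auto
  \<comment> \<open>No reduction modulo \<open>N\<close> here: as polynomials the products
    \<open>u * y\<close> are distinct, and they lie in \<open>deg_less (n + e)\<close>, which meets
    each residue class \<open>q ^ e\<close> times.\<close>
  also have "\<dots> = (\<Sum>z\<in>(\<lambda>u. u * y) ` R. (G z)\<^sup>2)"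
    using False by (subst sum.reindex) (auto simp: inj_on_def)
  also have "\<dots> \<le> (\<Sum>z\<in>deg_less (n + e). (G z)\<^sup>2)"
  proof (rule sum_mono2)
    have "u * y \<in> deg_less (n + e)" if "u \<in> R" for u
      using that e False by (cases "u = 0") (auto simp: deg_less_iff degree_mult_eq)
    then show "(\<lambda>u. u * y) ` R \<subseteq> deg_less (n + e)" by auto
  qed auto
  also have "\<dots> = real CARD('a) ^ e * (\<Sum>z\<in>R. (G z)\<^sup>2)"
    using sum_deg_less_periodic[of N "n + e" "\<lambda>z. (G z)\<^sup>2" 0] by (simp add: G_mod N_nonzero)
  also have "\<dots> \<le> real CARD('a) ^ e * (real CARD('a) ^ n * real (phi_poly N))"
    by (intro mult_left_mono sum_G_square) auto
  finally show ?thesis using phi_poly_pos by (simp add: power_add mult_ac)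
qed

text \<open>By \<open>sum_G\<close> the sum becomes one over \<open>q ^ (n - l)\<close> dual points,
  each at most \<open>sqrt (q ^ (n + (n - l)))\<close>; the number of points cancels, and the 2
  bounds the remaining \<open>q / (q - 1)\<close>. For \<open>l > n\<close> the left side is
  zero.\<close>

theorem polya_vinogradov: "\<bar>\<Sum>x\<in>deg_less l. \<psi> x\<bar> \<le> 2 * sqrt (real CARD('a) ^ (2 * n - l))"
proof (cases "l \<le> n")
  case False
  then show ?thesis using sum_deg_less_eq_0[of l 0] by simp
next
  case True
  have "(\<Sum>x\<in>deg_less l. \<psi> x) = (\<Sum>x\<in>R. \<psi> x * of_bool (x \<in> deg_less l))"
    using deg_less_mono[OF True]
    by (intro sum.mono_neutral_cong_left) auto
  then have "(real CARD('a) - 1) * real CARD('a) ^ (n - l) * (\<Sum>x\<in>deg_less l. \<psi> x) = real CARD('a) * (\<Sum>y\<in>deg_less (n - l). G y)"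
    by (simp add: sum_G)
  then have "\<bar>(real CARD('a) - 1) * real CARD('a) ^ (n - l) * (\<Sum>x\<in>deg_less l. \<psi> x)\<bar> =
      \<bar>real CARD('a) * (\<Sum>y\<in>deg_less (n - l). G y)\<bar>" by (rule arg_cong)
  then have "(real CARD('a) - 1) * real CARD('a) ^ (n - l) * \<bar>\<Sum>x\<in>deg_less l. \<psi> x\<bar> = real CARD('a) * \<bar>\<Sum>y\<in>deg_less (n - l). G y\<bar>"
    using card_gt_1 by (simp add: abs_mult)
  also have "\<dots> \<le> real CARD('a) * (\<Sum>y\<in>(deg_less (n - l) :: 'a poly set). sqrt (real CARD('a) ^ (n + (n - l))))"
  proof (rule mult_left_mono, rule order_trans[OF sum_abs], rule sum_mono)
    fix y :: "'a poly" assume "y \<in> deg_less (n - l)"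
    then show "\<bar>G y\<bar> \<le> sqrt (real CARD('a) ^ (n + (n - l)))"
      using G_square_le by (intro real_le_rsqrt) auto
  qed auto
  also have "\<dots> = real CARD('a) * real CARD('a) ^ (n - l) * sqrt (real CARD('a) ^ (2 * n - l))"
    using True by (simp add: card_deg_less mult_2)
  also have "\<dots> \<le> (2 * (real CARD('a) - 1)) * real CARD('a) ^ (n - l) * sqrt (real CARD('a) ^ (2 * n - l))"
  proof (intro mult_right_mono)
    have "CARD('a) \<ge> 2" using card_gt_1 by linarith
    then show "real CARD('a) \<le> 2 * (real CARD('a) - 1)" by simp
  qed auto
  finally have "((real CARD('a) - 1) * real CARD('a) ^ (n - l)) * \<bar>\<Sum>x\<in>deg_less l. \<psi> x\<bar> \<le>
      ((real CARD('a) - 1) * real CARD('a) ^ (n - l)) * (2 * sqrt (real CARD('a) ^ (2 * n - l)))" by (simp only: mult_ac)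
  then show ?thesis using card_gt_1 by (subst (asm) mult_le_cancel_left_pos) auto
qed

end

section \<open>Euler's criterion in the algebraic closure\<close>

text \<open>Multiplication by \<open>x\<close> permutes the nonzero elements and so preserves their
  product. A set \<open>F\<close> instead of a type serves both the base field and the residue
  fields inside its closure.\<close>

lemma power_card_eq_1:
  fixes F :: "'b::field set"
  assumes "finite F" "0 \<in> F" "\<And>x y. x \<in> F \<Longrightarrow> y \<in> F \<Longrightarrow> x * y \<in> F" "x \<in> F" "x \<noteq> 0"
  shows "x ^ (card F - 1) = 1"
proof -
  let ?G = "F - {0}"
  have inj: "inj_on ((*) x) ?G" using assms(5) by (auto simp: inj_on_def)
  have "(*) x ` ?G = ?G" using assms by (intro endo_inj_surj inj) auto
  then have "prod (\<lambda>y. y) ?G = prod (\<lambda>y. x * y) ?G"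
    using prod.reindex[OF inj, of "\<lambda>y. y"] by simp
  also have "\<dots> = x ^ card ?G * prod (\<lambda>y. y) ?G" by (simp add: prod.distrib)
  finally show ?thesis using assms by (simp add: prod_zero_iff)
qed

lemma finite_field_power_card: "(c::'a::{field,finite}) ^ CARD('a) = c"
proof (cases "c = 0")
  case False
  then have "c ^ (CARD('a) - 1) = 1" by (intro power_card_eq_1) auto
  then have "c * c ^ (CARD('a) - 1) = c" by simp
  then show ?thesis by (simp flip: power_Suc)
qed simp

text \<open>Avoids the structure theorem \<open>q = p ^ r\<close>: the polynomial \<open>(X + 1) ^ q - X ^ q - 1\<close> has degree
  less than \<open>q\<close> and vanishes at all \<open>q\<close> elements of the field.\<close>

lemma of_nat_card_choose_eq_0:
  assumes "0 < i" "i < CARD('a::{field,finite})"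
  shows "of_nat (CARD('a) choose i) = (0::'a)"
proof -
  let ?q = "CARD('a)"
  define g :: "'a poly" where "g = (\<Sum>j\<in>{1..<?q}. monom (of_nat (?q choose j)) j)"
  have "poly g c = 0" for c
  proof -
    have "c + 1 = (c + 1) ^ ?q" by (simp add: finite_field_power_card)
    also have "\<dots> = (\<Sum>j\<le>?q. of_nat (?q choose j) * c ^ j)"
      by (simp add: binomial_ring)
    also have "{..?q} = insert 0 (insert ?q {1..<?q})" using CARD_field_gt_1[where 'a='a] by auto
    also have "(\<Sum>j\<in>insert 0 (insert ?q {1..<?q}). of_nat (?q choose j) * c ^ j) = 1 + (c + poly g c)"
      using CARD_field_gt_1[where 'a='a] by (simp add: g_def poly_sum poly_monom finite_field_power_card)
    finally show ?thesis by simp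
  qed
  moreover have "degree g < ?q"
  proof -
    have "degree g \<le> ?q - 1"
      unfolding g_def by (intro degree_sum_le) (auto intro: order_trans[OF degree_monom_le])
    then show ?thesis using CARD_field_gt_1[where 'a='a] by linarith
  qed
  ultimately have "g = 0"
    using CARD_field_gt_1[where 'a='a] by (intro poly_eqI_degree[where A = UNIV]) auto
  then have "coeff g i = 0" by simp
  then show ?thesis using assms by (simp add: g_def coeff_sum)
qed

lemma frobenius_add:
  fixes x y :: "'a::{field,finite} alg_closure"
  shows "(x + y) ^ CARD('a) = x ^ CARD('a) + y ^ CARD('a)"
proof -
  let ?q = "CARD('a)"
  have *: "of_nat (?q choose i) = (0 :: 'a alg_closure)" if "i \<in> {1..<?q}" for i
    using of_nat_card_choose_eq_0[where 'a='a, of i] that by (metis atLeastLessThan_iff less_eq_Suc_le One_nat_def to_ac_0 to_ac_of_nat)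
  have "(x + y) ^ ?q = (\<Sum>j\<le>?q. of_nat (?q choose j) * x ^ j * y ^ (?q - j))" by (rule binomial_ring)
  also have "{..?q} = insert 0 (insert ?q {1..<?q})" using CARD_field_gt_1[where 'a='a] by auto
  also have "(\<Sum>j\<in>insert 0 (insert ?q {1..<?q}). of_nat (?q choose j) * x ^ j * y ^ (?q - j)) = x ^ ?q + y ^ ?q"
    using * by simp
  finally show ?thesis .
qed

text \<open>Translation by 1 preserves the sum of all elements, so \<open>q = 0\<close> in the
  field; together with \<open>2 = 0\<close> and \<open>q\<close> odd this would give
  \<open>1 = 0\<close>.\<close>

lemma two_neq_0_field:
  assumes "odd CARD('a::{field,finite})" shows "(2::'a) \<noteq> 0"
proof
  assume two: "(2::'a) = 0"
  have "(\<Sum>x\<in>UNIV. x :: 'a) = (\<Sum>x\<in>UNIV. x + 1)"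
    by (rule sum.reindex_bij_witness[of _ "\<lambda>x. x + 1" "\<lambda>x. x - 1"]) auto
  then have "of_nat CARD('a) = (0::'a)" by (simp add: sum.distrib)
  moreover obtain k where "CARD('a) = 2 * k + 1" using assms by (rule oddE)
  ultimately show False using two by simp
qed

section \<open>Evaluation in the algebraic closure\<close>

definition ac_eval :: "'a::field alg_closure \<Rightarrow> 'a poly \<Rightarrow> 'a alg_closure"
  where "ac_eval x b = poly (map_poly to_ac b) x"

lemma map_poly_to_ac_add: "map_poly to_ac (a + b) = map_poly to_ac a + map_poly to_ac b"
  by (rule poly_eqI) (simp add: coeff_map_poly)

lemma map_poly_to_ac_mult: "map_poly to_ac (a * b) = map_poly to_ac a * map_poly to_ac b"
  by (rule poly_eqI) (simp add: coeff_map_poly coeff_mult to_ac_sum)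

lemma degree_map_poly_to_ac: "degree (map_poly to_ac a) = degree a"
  by (cases "a = 0") (auto intro: map_poly_degree_eq)

lemma map_poly_to_ac_eq_0_iff: "map_poly to_ac a = 0 \<longleftrightarrow> a = 0"
  by (rule map_poly_eq_0_iff) auto

lemma ac_eval_0 [simp]: "ac_eval x 0 = 0" and ac_eval_1 [simp]: "ac_eval x 1 = 1"
  and ac_eval_add: "ac_eval x (a + b) = ac_eval x a + ac_eval x b"
  and ac_eval_mult: "ac_eval x (a * b) = ac_eval x a * ac_eval x b"
  and ac_eval_pCons: "ac_eval x (pCons c a) = to_ac c + x * ac_eval x a"
  by (simp_all add: ac_eval_def map_poly_to_ac_add map_poly_to_ac_mult map_poly_pCons)

lemma ac_eval_diff: "ac_eval x (a - b) = ac_eval x a - ac_eval x b"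
  using ac_eval_add[of x "a - b" b] by (simp add: algebra_simps)

lemma ac_eval_power: "ac_eval x (a ^ n) = ac_eval x a ^ n"
  by (induction n) (simp_all add: ac_eval_mult)

text \<open>Taking \<open>q\<close>-th powers is additive and multiplicative and fixes the
  coefficients of \<open>b\<close>.\<close>

lemma ac_eval_frobenius:
  "ac_eval (x ^ CARD('a)) (b :: 'a::{field,finite} poly) = ac_eval x b ^ CARD('a)"
proof (induction b)
  case (pCons c b)
  have "to_ac c ^ CARD('a) = to_ac c" by (simp add: finite_field_power_card flip: to_ac_power)
  then show ?case using pCons by (simp add: ac_eval_pCons frobenius_add power_mult_distrib)
qed (simp add: power_0_left)

lemma ac_eval_frobenius_power:
  "ac_eval (x ^ (CARD('a) ^ i)) (b :: 'a::{field,finite} poly) = ac_eval x b ^ (CARD('a) ^ i)"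
proof (induction i)
  case (Suc i)
  have "x ^ (CARD('a) ^ Suc i) = (x ^ (CARD('a) ^ i)) ^ CARD('a)" for x :: "'a alg_closure"
    by (simp add: mult.commute flip: power_mult)
  then show ?case using Suc by (simp add: ac_eval_frobenius)
qed simp

text \<open>Realises \<open>A / p\<close> as the set of values at a root of \<open>p\<close>, so
  that the residue fields of all \<open>p\<close>, and all their roots, lie in one field.\<close>

locale irreducible_root =
  fixes p :: "'a::{field,finite} poly" and \<alpha> :: "'a alg_closure"
  assumes irred: "irreducible p" and root: "ac_eval \<alpha> p = 0"
begin

lemma ac_eval_eq_0_iff: "ac_eval \<alpha> b = 0 \<longleftrightarrow> p dvd b"
proof
  assume b: "ac_eval \<alpha> b = 0"
  show "p dvd b"
  proof (rule ccontr)
    assume "\<not> p dvd b"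
    then have "coprime p b" by (rule irreducible_imp_coprime_poly[OF irred])
    then obtain x y where "x * p + y * b = 1" by (rule bezout_poly)
    then have "ac_eval \<alpha> (x * p + y * b) = 1" by simp
    then show False using b root by (simp add: ac_eval_add ac_eval_mult)
  qed
qed (auto simp: ac_eval_mult root)

lemma ac_eval_eq_iff: "ac_eval \<alpha> a = ac_eval \<alpha> b \<longleftrightarrow> p dvd a - b"
  by (simp flip: ac_eval_eq_0_iff add: ac_eval_diff)

definition residue_field :: "'a alg_closure set" where "residue_field = range (ac_eval \<alpha>)"

abbreviation "Q \<equiv> CARD('a) ^ degree p"

lemma residue_field_eq: "residue_field = ac_eval \<alpha> ` deg_less (degree p)"
proof -
  have "p \<noteq> 0" using irred by auto
  then have "ac_eval \<alpha> b \<in> ac_eval \<alpha> ` deg_less (degree p)" for b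
    by (intro image_eqI[of _ _ "b mod p"])
      (auto simp: ac_eval_eq_iff mod_in_deg_less minus_mod_eq_mult_div)
  then show ?thesis by (auto simp: residue_field_def)
qed

lemma inj_ac_eval: "inj_on (ac_eval \<alpha>) (deg_less (degree p))"
proof (rule inj_onI)
  fix a b assume "a \<in> deg_less (degree p)" "b \<in> deg_less (degree p)" "ac_eval \<alpha> a = ac_eval \<alpha> b"
  then show "a = b" by (metis ac_eval_eq_iff mod_deg_less mod_eq_dvd_iff)
qed

lemma card_residue_field: "card residue_field = Q"
  and finite_residue_field: "finite residue_field"
  by (simp_all add: residue_field_eq card_image[OF inj_ac_eval] card_deg_less)

lemma residue_field_mult: "x \<in> residue_field \<Longrightarrow> y \<in> residue_field \<Longrightarrow> x * y \<in> residue_field"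
  by (auto simp: residue_field_def ac_eval_mult[symmetric])

lemma zero_in_residue_field: "0 \<in> residue_field"
  unfolding residue_field_def by (metis ac_eval_0 rangeI)

lemma power_Q_minus_1: "x \<in> residue_field \<Longrightarrow> x \<noteq> 0 \<Longrightarrow> x ^ (Q - 1) = 1"
  using power_card_eq_1[OF finite_residue_field zero_in_residue_field residue_field_mult]
  by (simp add: card_residue_field)

lemma power_Q: "x \<in> residue_field \<Longrightarrow> x ^ Q = x"
proof (cases "x = 0")
  case False
  assume "x \<in> residue_field"
  then have "x * x ^ (Q - 1) = x" using power_Q_minus_1 False by simp
  then show ?thesis by (simp flip: power_Suc)
qed (simp add: power_0_left)

lemma Q_gt_1: "Q > 1"
  using irreducible_degree_pos[OF irred] by (intro one_less_power CARD_field_gt_1)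

lemma card_power_roots: "m > 0 \<Longrightarrow> card {x::'a alg_closure. x ^ m = 1} \<le> m"
  and finite_power_roots: "m > 0 \<Longrightarrow> finite {x::'a alg_closure. x ^ m = 1}"
proof -
  assume m: "m > 0"
  let ?p = "monom 1 m - 1 :: 'a alg_closure poly"
  have "coeff ?p m = 1" using m by simp
  then have "?p \<noteq> 0" by (metis coeff_0 zero_neq_one)
  moreover have "{x. poly ?p x = 0} = {x. x ^ m = 1}" by (simp add: poly_monom)
  moreover have "degree ?p \<le> m" by (intro degree_diff_le degree_monom_le) simp
  ultimately show "card {x::'a alg_closure. x ^ m = 1} \<le> m" "finite {x::'a alg_closure. x ^ m = 1}"
    using card_poly_roots_bound[of ?p] poly_roots_finite[of ?p] by auto
qed

text \<open>Squaring is at most two-to-one, so there are at least \<open>(Q - 1) / 2\<close> nonzero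
  squares; all satisfy an equation with at most that many roots.\<close>

lemma squares_eq:
  assumes "odd CARD('a)"
  shows "(\<lambda>x. x ^ 2) ` (residue_field - {0}) = {x. x ^ ((Q - 1) div 2) = 1}"
proof -
  define H where "H = (Q - 1) div 2"
  have Q: "2 * H = Q - 1" using assms by (simp add: H_def)
  have H: "H > 0" using Q Q_gt_1 by linarith
  have sub: "(\<lambda>x. x ^ 2) ` (residue_field - {0}) \<subseteq> {x. x ^ H = 1}"
    using power_Q_minus_1 by (auto simp flip: power_mult simp add: Q)
  let ?S = "(\<lambda>x. x ^ 2) ` (residue_field - {0})"
  have fib: "card {x \<in> residue_field - {0}. x ^ 2 = s} \<le> 2" for s
  proof (cases "\<exists>y. y ^ 2 = s")
    case True
    then obtain y where y: "y ^ 2 = s" by auto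
    have "{x \<in> residue_field - {0}. x ^ 2 = s} \<subseteq> {y, - y}"
      using y by (auto simp: power2_eq_iff)
    then have "card {x \<in> residue_field - {0}. x ^ 2 = s} \<le> card {y, - y}" by (intro card_mono) auto
    also have "\<dots> \<le> 2" by (simp add: card_insert_if)
    finally show ?thesis .
  qed auto
  have "Q - 1 = card (residue_field - {0})"
    using zero_in_residue_field finite_residue_field by (simp add: card_residue_field)
  also have "residue_field - {0} = (\<Union>s\<in>?S. {x \<in> residue_field - {0}. x ^ 2 = s})" by auto
  also have "card \<dots> \<le> (\<Sum>s\<in>?S. card {x \<in> residue_field - {0}. x ^ 2 = s})"
    using finite_residue_field by (intro card_UN_le) auto
  also have "\<dots> \<le> (\<Sum>s\<in>?S. 2)" by (intro sum_mono fib)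
  finally have "H \<le> card ?S" using Q by simp
  then have "card {x::'a alg_closure. x ^ H = 1} \<le> card ?S" using card_power_roots[OF H] by linarith
  with sub have "?S = {x. x ^ H = 1}" by (intro card_seteq finite_power_roots H)
  then show ?thesis by (simp add: H_def)
qed

lemma euler_criterion:
  assumes "odd CARD('a)"
  shows "of_int (Legendre_symbol b p) = ac_eval \<alpha> b ^ ((Q - 1) div 2)"
proof -
  define H where "H = (Q - 1) div 2"
  have Q: "2 * H = Q - 1" using assms by (simp add: H_def)
  \<comment> \<open>Makes \<open>0 ^ H = 0\<close>, the value of the symbol when \<open>p\<close>
    divides \<open>b\<close>.\<close>
  have H: "H > 0" using Q Q_gt_1 by linarith
  have "of_int (Legendre_symbol b p) = ac_eval \<alpha> b ^ H"
  proof (cases "p dvd b")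
    case True
    then show ?thesis using H by (simp add: Legendre_symbol_def ac_eval_eq_0_iff[symmetric])
  next
    case False
    then have nz: "ac_eval \<alpha> b \<noteq> 0" by (simp add: ac_eval_eq_0_iff)
    have "(ac_eval \<alpha> b ^ H) ^ 2 = ac_eval \<alpha> b ^ (2 * H)" by (simp add: mult.commute flip: power_mult)
    also have "\<dots> = 1" unfolding Q using nz by (intro power_Q_minus_1) (simp_all add: residue_field_def)
    finally have "(ac_eval \<alpha> b ^ H) ^ 2 = 1" .
    then have *: "ac_eval \<alpha> b ^ H = 1 \<or> ac_eval \<alpha> b ^ H = - 1" by (simp add: power2_eq_1_iff)
    have "(\<exists>c. p dvd c ^ 2 - b) \<longleftrightarrow> (\<exists>c. ac_eval \<alpha> c ^ 2 = ac_eval \<alpha> b)"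
      by (simp flip: ac_eval_eq_iff add: ac_eval_power)
    also have "\<dots> \<longleftrightarrow> ac_eval \<alpha> b \<in> (\<lambda>x. x ^ 2) ` (residue_field - {0})"
    proof
      assume "\<exists>c. ac_eval \<alpha> c ^ 2 = ac_eval \<alpha> b"
      then obtain c where c: "ac_eval \<alpha> c ^ 2 = ac_eval \<alpha> b" ..
      then have "ac_eval \<alpha> c \<noteq> 0" using nz by auto
      then show "ac_eval \<alpha> b \<in> (\<lambda>x. x ^ 2) ` (residue_field - {0})"
        unfolding c[symmetric] by (simp add: residue_field_def)
    qed (auto simp: residue_field_def)
    also have "\<dots> \<longleftrightarrow> ac_eval \<alpha> b ^ H = 1" by (simp add: squares_eq[OF assms] H_def)
    finally show ?thesis using * False by (auto simp: Legendre_symbol_def)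
  qed
  then show ?thesis by (simp add: H_def)
qed

text \<open>The equation \<open>x ^ ((Q - 1) / 2) = 1\<close> has fewer roots than there are nonzero
  residues.\<close>

lemma exists_nonresidue:
  assumes "odd CARD('a)" shows "\<exists>b. Legendre_symbol b p = - 1"
proof -
  let ?H = "(Q - 1) div 2"
  have Q: "2 * ?H = Q - 1" using assms by simp
  have H: "?H > 0" using Q Q_gt_1 by linarith
  have "card {x::'a alg_closure. x ^ ?H = 1} < card (residue_field - {0})"
    using card_power_roots[OF H] Q H zero_in_residue_field finite_residue_field
    by (simp add: card_residue_field)
  then have "\<not> residue_field - {0} \<subseteq> {x. x ^ ?H = 1}"
    using card_mono[OF finite_power_roots[OF H]] by (meson not_le)
  then obtain x where x: "x \<in> residue_field" "x \<noteq> 0" "x ^ ?H \<noteq> 1" by auto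
  then obtain b where b: "x = ac_eval \<alpha> b" by (auto simp: residue_field_def)
  have "of_int (Legendre_symbol b p) \<noteq> (1 :: 'a alg_closure)"
    unfolding euler_criterion[OF assms] using x b by simp
  moreover have "\<not> p dvd b" using x b by (simp add: ac_eval_eq_0_iff)
  ultimately have "Legendre_symbol b p = - 1" by (auto simp: Legendre_symbol_def split: if_splits)
  then show ?thesis ..
qed

text \<open>The iterated \<open>q\<close>-th powers of \<open>\<alpha>\<close> are
  \<open>degree p\<close> distinct roots, so by the degree there are no others and all are
  simple.\<close>

lemma proots_irreducible:
  "proots (map_poly to_ac p) = image_mset (\<lambda>i. \<alpha> ^ (CARD('a) ^ i)) (mset_set {..<degree p})"
proof -
  let ?k = "degree p" and ?P = "map_poly to_ac p" and ?q = "CARD('a)"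
  let ?S = "(\<lambda>i. \<alpha> ^ (?q ^ i)) ` {..<?k}"
  have \<alpha>: "\<alpha> \<in> residue_field"
    unfolding residue_field_def using ac_eval_pCons[of \<alpha> 0 1] by (metis ac_eval_1 add_0 mult.right_neutral rangeI to_ac_0)
  have P: "?P \<noteq> 0" using irred by (auto simp: map_poly_to_ac_eq_0_iff)
  \<comment> \<open>If \<open>\<alpha>\<close> were fixed by the \<open>q ^ e\<close>-th power, so
    would be every value at \<open>\<alpha>\<close>, giving all \<open>Q - 1\<close> nonzero
    residues as roots of an equation of smaller degree.\<close>
  have neq: "\<alpha> ^ (?q ^ e) \<noteq> \<alpha>" if "0 < e" "e < ?k" for e
  proof
    assume eq: "\<alpha> ^ (?q ^ e) = \<alpha>"
    have q: "?q ^ e > 1" using that by (intro one_less_power CARD_field_gt_1)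
    have "x ^ (?q ^ e - 1) = 1" if x: "x \<in> residue_field - {0}" for x
    proof -
      obtain b where b: "x = ac_eval \<alpha> b" using x by (auto simp: residue_field_def)
      have "x ^ (?q ^ e) = x" using ac_eval_frobenius_power[of \<alpha> e b] by (simp add: b eq)
      moreover have "x ^ (?q ^ e) = x * x ^ (?q ^ e - 1)" using q by (simp flip: power_Suc)
      ultimately show ?thesis using x by simp
    qed
    then have "card (residue_field - {0}) \<le> card {x::'a alg_closure. x ^ (?q ^ e - 1) = 1}"
      using q by (intro card_mono finite_power_roots) auto
    also have "\<dots> \<le> ?q ^ e - 1" using q by (intro card_power_roots) auto
    finally have "Q - 1 \<le> ?q ^ e - 1"
      using zero_in_residue_field finite_residue_field by (simp add: card_residue_field)
    moreover have "?q ^ e < Q"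
      using that CARD_field_gt_1[where 'a='a] by (intro power_strict_increasing) auto
    ultimately show False using q by linarith
  qed
  have inj: "inj_on (\<lambda>i. \<alpha> ^ (?q ^ i)) {..<?k}"
  proof (rule linorder_inj_onI)
    fix i j assume ij: "i < j" "i \<in> {..<?k}" "j \<in> {..<?k}"
    show "\<alpha> ^ (?q ^ i) \<noteq> \<alpha> ^ (?q ^ j)"
    proof
      assume "\<alpha> ^ (?q ^ i) = \<alpha> ^ (?q ^ j)"
      \<comment> \<open>This power takes the right side to \<open>\<alpha> ^ Q = \<alpha>\<close>
        and leaves on the left an exponent excluded by \<open>neq\<close>.\<close>
      then have "(\<alpha> ^ (?q ^ i)) ^ (?q ^ (?k - j)) = (\<alpha> ^ (?q ^ j)) ^ (?q ^ (?k - j))" by simp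
      then have "\<alpha> ^ (?q ^ (i + (?k - j))) = \<alpha> ^ (?q ^ (j + (?k - j)))"
        by (simp add: power_add flip: power_mult)
      then have "\<alpha> ^ (?q ^ (i + (?k - j))) = \<alpha>" using power_Q[OF \<alpha>] ij by simp
      moreover have "\<alpha> ^ (?q ^ (i + (?k - j))) \<noteq> \<alpha>" using ij by (intro neq) auto
      ultimately show False by simp
    qed
  qed auto
  have "ac_eval (\<alpha> ^ (?q ^ i)) p = 0" for i
    by (simp add: ac_eval_frobenius_power root power_0_left)
  then have "?S \<subseteq> set_mset (proots ?P)" using P by (auto simp: ac_eval_def)
  then have "mset_set ?S \<subseteq># mset_set (set_mset (proots ?P))"
    by (intro subset_imp_msubset_mset_set) auto
  also have "\<dots> \<subseteq># proots ?P" by (rule mset_set_set_mset_msubset)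
  finally have sub: "mset_set ?S \<subseteq># proots ?P" .
  moreover have "size (proots ?P) \<le> size (mset_set ?S)"
    using size_proots_le[of ?P] by (simp add: card_image[OF inj] degree_map_poly_to_ac)
  ultimately have "mset_set ?S = proots ?P"
    by (metis mset_subset_size not_le subset_mset.le_imp_less_or_eq)
  then show ?thesis using image_mset_mset_set[OF inj] by simp
qed

text \<open>The geometric sum \<open>(Q - 1) / 2 = (q - 1) / 2 * (1 + q + ... + q ^ (degree p -
  1))\<close> distributes Euler's exponent over the conjugates of \<open>\<alpha>\<close>. The
  exponent left at each root no longer depends on \<open>p\<close>.\<close>

lemma Legendre_symbol_eq_prod_roots:
  assumes "odd CARD('a)"
  shows "of_int (Legendre_symbol b p) =
    (\<Prod>x\<in>#proots (map_poly to_ac p). ac_eval x b ^ ((CARD('a) - 1) div 2))"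
proof -
  let ?q = "CARD('a)" and ?h = "(CARD('a) - 1) div 2"
  have h: "2 * ?h = ?q - 1" using assms by simp
  define S where "S = (\<Sum>i<degree p. ?q ^ i * ?h)"
  have "int (2 * S) = int (2 * ?h) * (\<Sum>i<degree p. int ?q ^ i)"
    by (simp add: S_def sum_distrib_left sum_distrib_right mult_ac)
  also have "\<dots> = (int ?q - 1) * (\<Sum>i<degree p. int ?q ^ i)" unfolding h by simp
  also have "\<dots> = int ?q ^ degree p - 1" by (rule power_diff_1_eq[symmetric])
  also have "\<dots> = int Q - 1" by simp
  finally have "2 * S = Q - 1" by linarith
  then have H: "(\<Sum>i<degree p. ?q ^ i * ?h) = (Q - 1) div 2" by (simp add: S_def)
  have "(\<Prod>x\<in>#proots (map_poly to_ac p). ac_eval x b ^ ?h) =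
      (\<Prod>i<degree p. ac_eval (\<alpha> ^ (?q ^ i)) b ^ ?h)"
    by (simp add: proots_irreducible image_mset.compositionality comp_def prod_unfold_prod_mset)
  also have "\<dots> = ac_eval \<alpha> b ^ (\<Sum>i<degree p. ?q ^ i * ?h)"
    by (simp add: ac_eval_frobenius_power power_sum flip: power_mult)
  finally show ?thesis by (simp only: H euler_criterion[OF assms])
qed

end

lemma exists_irreducible_root:
  fixes p :: "'a::{field,finite} poly"
  assumes "irreducible p" obtains \<alpha> where "irreducible_root p \<alpha>"
proof -
  have "degree (map_poly to_ac p) > 0" using irreducible_degree_pos[OF assms] by (simp add: degree_map_poly_to_ac)
  then obtain \<alpha> where "poly (map_poly to_ac p) \<alpha> = 0" using alg_closed_imp_poly_has_root by blast
  then show ?thesis using assms that by (simp add: irreducible_root_def ac_eval_def)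
qed

section \<open>The Jacobi symbol and reciprocity\<close>

lemma finite_monic_prime_divisors: "a \<noteq> 0 \<Longrightarrow> finite (monic_prime_divisors a)"
  by (rule finite_subset[of _ "deg_less (Suc (degree a))"])
    (auto simp: monic_prime_divisors_def deg_less_iff less_Suc_eq_le dvd_imp_degree_le)

text \<open>The degree of \<open>a\<close> bounds every exponent, so the \<open>GREATEST\<close> in
  the definition is attained.\<close>

lemma power_dvd_iff_multiplicity:
  assumes "irreducible p" "a \<noteq> 0"
  shows "p ^ n dvd a \<longleftrightarrow> n \<le> multiplicity_poly p a"
proof -
  have bound: "m \<le> degree a" if "p ^ m dvd a" for m
  proof -
    have "m * 1 \<le> m * degree p" using irreducible_degree_pos[OF assms(1)] by (intro mult_le_mono2) simp
    also have "\<dots> = degree (p ^ m)" using assms by (intro degree_power_eq[symmetric]) auto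
    also have "\<dots> \<le> degree a" using that assms by (intro dvd_imp_degree_le)
    finally show ?thesis by simp
  qed
  have "p ^ 0 dvd a" by simp
  then have "p ^ multiplicity_poly p a dvd a"
    unfolding multiplicity_poly_def using bound by (rule GreatestI_nat)
  moreover have "n \<le> multiplicity_poly p a" if "p ^ n dvd a"
    unfolding multiplicity_poly_def using that bound by (rule Greatest_le_nat)
  ultimately show ?thesis by (metis dvd_trans le_imp_power_dvd)
qed

lemma multiplicity_decomposition:
  assumes "irreducible p" "a \<noteq> 0"
  obtains b where "a = p ^ multiplicity_poly p a * b" "\<not> p dvd b"
proof -
  obtain b where b: "a = p ^ multiplicity_poly p a * b"
    using power_dvd_iff_multiplicity[OF assms, of "multiplicity_poly p a"] by auto
  have "\<not> p dvd b"
  proof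
    assume "p dvd b"
    then have "p ^ Suc (multiplicity_poly p a) dvd a"
      by (subst b) (simp add: mult.commute mult_dvd_mono)
    then show False 
      using power_dvd_iff_multiplicity[OF assms, of "Suc (multiplicity_poly p a)"] by (simp del: power_Suc)
  qed
  then show ?thesis using b that by blast
qed

lemma multiplicity_eqI:
  assumes "irreducible p" "\<not> p dvd b" shows "multiplicity_poly p (p ^ j * b) = j"
proof -
  have nz: "p ^ j * b \<noteq> 0" using assms by auto
  have "j \<le> multiplicity_poly p (p ^ j * b)"
    by (subst power_dvd_iff_multiplicity[symmetric]) (use assms nz in auto)
  moreover have "\<not> Suc j \<le> multiplicity_poly p (p ^ j * b)"
  proof
    assume "Suc j \<le> multiplicity_poly p (p ^ j * b)"
    then have "p ^ j * p dvd p ^ j * b"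
      using power_dvd_iff_multiplicity[OF assms(1) nz, of "Suc j"] by (simp add: mult.commute)
    then show False using assms by auto
  qed
  ultimately show ?thesis by simp
qed

lemma multiplicity_eq_0: "irreducible p \<Longrightarrow> \<not> p dvd a \<Longrightarrow> multiplicity_poly p a = 0"
  using multiplicity_eqI[of p a 0] by simp

lemma multiplicity_mult:
  assumes "irreducible p" "a \<noteq> 0" "b \<noteq> 0"
  shows "multiplicity_poly p (a * b) = multiplicity_poly p a + multiplicity_poly p b"
proof -
  obtain a' where a: "a = p ^ multiplicity_poly p a * a'" "\<not> p dvd a'"
    using assms multiplicity_decomposition by blast
  obtain b' where b: "b = p ^ multiplicity_poly p b * b'" "\<not> p dvd b'"
    using assms multiplicity_decomposition by blast
  have "a * b = p ^ (multiplicity_poly p a + multiplicity_poly p b) * (a' * b')"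
    by (subst a(1), subst b(1)) (simp add: power_add mult_ac)
  moreover have "\<not> p dvd a' * b'" using a b assms by (simp add: irreducible_dvd_mult_iff)
  ultimately show ?thesis using multiplicity_eqI[OF assms(1)] by simp
qed

section \<open>Basic properties of the Jacobi symbol\<close>

lemma monic_prime_divisors_mult:
  "monic_prime_divisors (a * b) = monic_prime_divisors a \<union> monic_prime_divisors b"
  by (auto simp: monic_prime_divisors_def irreducible_dvd_mult_iff)

lemma monic_prime_divisors_1 [simp]: "monic_prime_divisors 1 = {}"
  by (auto simp: monic_prime_divisors_def dest: irreducible_not_unit)

lemma monic_prime_divisors_prime:
  "monic p \<Longrightarrow> irreducible p \<Longrightarrow> monic_prime_divisors p = {p}"
  by (auto simp: monic_prime_divisors_def intro: monic_irreducible_dvd_eq)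

text \<open>Primes of multiplicity 0 contribute 1; this allows a common index set for two lower
  arguments.\<close>

lemma Jacobi_symbol_superset:
  assumes "finite S" "monic_prime_divisors a \<subseteq> S" "\<And>p. p \<in> S \<Longrightarrow> monic p \<and> irreducible p"
  shows "Jacobi_symbol b a = (\<Prod>p\<in>S. Legendre_symbol b p ^ multiplicity_poly p a)"
  unfolding Jacobi_symbol_def
proof (rule prod.mono_neutral_left)
  show "\<forall>p\<in>S - monic_prime_divisors a. Legendre_symbol b p ^ multiplicity_poly p a = 1"
  proof
    fix p assume p: "p \<in> S - monic_prime_divisors a"
    then have "\<not> p dvd a" "irreducible p" using assms(3)[of p] by (auto simp: monic_prime_divisors_def)
    then show "Legendre_symbol b p ^ multiplicity_poly p a = 1" by (simp add: multiplicity_eq_0)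
  qed
qed (use assms in auto)

lemma Jacobi_symbol_mult_right:
  assumes "a \<noteq> 0" "a' \<noteq> 0"
  shows "Jacobi_symbol b (a * a') = Jacobi_symbol b a * Jacobi_symbol b a'"
proof -
  let ?S = "monic_prime_divisors a \<union> monic_prime_divisors a'"
  have "finite ?S" using assms by (simp add: finite_monic_prime_divisors)
  moreover have S: "monic p \<and> irreducible p" if "p \<in> ?S" for p using that by (auto simp: monic_prime_divisors_def)
  ultimately have "Jacobi_symbol b x = (\<Prod>p\<in>?S. Legendre_symbol b p ^ multiplicity_poly p x)"
    if "monic_prime_divisors x \<subseteq> ?S" for x
    using that by (intro Jacobi_symbol_superset) auto
  then show ?thesis using assms S
    by (simp add: monic_prime_divisors_mult prod.distrib[symmetric] power_add[symmetric] multiplicity_mult)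
qed

lemma Jacobi_symbol_1_right [simp]: "Jacobi_symbol b 1 = 1"
  by (simp add: Jacobi_symbol_def)

lemma Jacobi_symbol_prime:
  assumes "monic p" "irreducible p" shows "Jacobi_symbol b p = Legendre_symbol b p"
proof -
  have "\<not> p dvd 1" using assms irreducible_not_unit by blast
  then have "multiplicity_poly p p = 1" using multiplicity_eqI[OF assms(2), of 1 1] by simp
  then show ?thesis using assms by (simp add: Jacobi_symbol_def monic_prime_divisors_prime)
qed

lemma Jacobi_symbol_power_right: "a \<noteq> 0 \<Longrightarrow> Jacobi_symbol b (a ^ n) = Jacobi_symbol b a ^ n"
  by (induction n) (simp_all add: Jacobi_symbol_mult_right)

lemma abs_Jacobi_symbol: "monic a \<Longrightarrow> \<bar>Jacobi_symbol b a\<bar> = of_bool (coprime b a)"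
proof (induction a rule: monic_prime_induct)
  case (prime p a)
  have "\<bar>Legendre_symbol b p\<bar> = of_bool (coprime b p)"
  proof (cases "p dvd b")
    case True
    then have "\<not> coprime b p" using prime irreducible_not_unit[of p] by (auto dest: coprime_common_divisor)
    then show ?thesis using True by (simp add: Legendre_symbol_def)
  next
    case False
    then have "coprime b p" using irreducible_imp_coprime_poly[of p b] prime by (simp add: coprime_commute)
    then show ?thesis using False by (auto simp: Legendre_symbol_def)
  qed
  then show ?case using prime monic_nonzero[of a] monic_nonzero[of p]
    by (auto simp: Jacobi_symbol_mult_right Jacobi_symbol_prime abs_mult coprime_poly_mult_right_iff)
qed simp

lemma Legendre_symbol_cong:
  assumes "p dvd b - b'" shows "Legendre_symbol b p = Legendre_symbol b' p"
proof -
  have "p dvd c - b \<longleftrightarrow> p dvd c - b'" for c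
  proof -
    have "p dvd (b - b') + (c - b) \<longleftrightarrow> p dvd c - b" using assms by (rule dvd_add_right_iff)
    then show ?thesis by simp
  qed
  moreover have "p dvd b \<longleftrightarrow> p dvd b'"
    using dvd_add_right_iff[OF assms, of b'] by simp
  ultimately show ?thesis by (simp add: Legendre_symbol_def)
qed

lemma Jacobi_symbol_cong: "a dvd b - b' \<Longrightarrow> Jacobi_symbol b a = Jacobi_symbol b' a"
  unfolding Jacobi_symbol_def
proof (rule prod.cong[OF refl])
  fix p assume "a dvd b - b'" "p \<in> monic_prime_divisors a"
  then have "p dvd b - b'" by (auto simp: monic_prime_divisors_def intro: dvd_trans)
  then show "Legendre_symbol b p ^ multiplicity_poly p a = Legendre_symbol b' p ^ multiplicity_poly p a"
    using Legendre_symbol_cong[of p b b'] by simp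
qed

section \<open>The Jacobi symbol as a product over roots\<close>

text \<open>Brings identities between symbols back from the closure: in odd characteristic
  \<open>-1\<close>, \<open>0\<close> and \<open>1\<close> are distinct.\<close>

lemma of_int_alg_closure_inject:
  assumes "odd CARD('a::{field,finite})" "\<bar>i\<bar> \<le> 1" "\<bar>j\<bar> \<le> 1" "of_int i = (of_int j :: 'a alg_closure)"
  shows "i = j"
proof -
  have "(2 :: 'a alg_closure) \<noteq> 0"
    using two_neq_0_field[OF assms(1)] to_ac_eq_0_iff[of "2::'a"] by simp
  then have "(1 :: 'a alg_closure) \<noteq> - 1" by (simp add: eq_neg_iff_add_eq_0)
  then have neq: "(1 :: 'a alg_closure) \<noteq> - 1" "- 1 \<noteq> (1 :: 'a alg_closure)" by auto
  have "i \<in> {- 1, 0, 1}" "j \<in> {- 1, 0, 1}" using assms(2,3) by auto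
  then show ?thesis using assms(4) neq by auto
qed

lemma prod_mset_power: "(\<Prod>x\<in>#A. f x) ^ n = (\<Prod>x\<in>#A. f x ^ n :: 'b::comm_monoid_mult)"
  by (induction A) (simp_all add: power_mult_distrib)

text \<open>The exponent is the same for every prime factor, so the formulas for primes multiply;
  counting roots with multiplicity accounts for prime powers.\<close>

lemma Jacobi_symbol_eq_prod_roots:
  assumes "odd CARD('a::{field,finite})" "monic (a :: 'a poly)"
  shows "of_int (Jacobi_symbol b a) =
    (\<Prod>x\<in>#proots (map_poly to_ac a). ac_eval x b ^ ((CARD('a) - 1) div 2))"
  using assms(2)
proof (induction a rule: monic_prime_induct)
  case (prime p a)
  obtain \<alpha> where "irreducible_root p \<alpha>" using prime exists_irreducible_root by blast
  then interpret irreducible_root p \<alpha> .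
  have nz: "p \<noteq> 0" "a \<noteq> 0" using prime by auto
  then have "map_poly to_ac p * map_poly to_ac a \<noteq> 0" by (simp add: map_poly_to_ac_eq_0_iff)
  then show ?case using prime nz
    by (simp add: Jacobi_symbol_mult_right Jacobi_symbol_prime map_poly_to_ac_mult proots_mult
        Legendre_symbol_eq_prod_roots[OF assms(1)])
qed simp

lemma Jacobi_symbol_mult_left:
  assumes "odd CARD('a::{field,finite})" "monic (a :: 'a poly)"
  shows "Jacobi_symbol (b * b') a = Jacobi_symbol b a * Jacobi_symbol b' a"
proof (rule of_int_alg_closure_inject[OF assms(1)])
  show "of_int (Jacobi_symbol (b * b') a) = (of_int (Jacobi_symbol b a * Jacobi_symbol b' a) :: 'a alg_closure)"
    by (simp add: Jacobi_symbol_eq_prod_roots[OF assms] ac_eval_mult power_mult_distrib prod_mset.distrib)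
qed (use assms(2) in \<open>auto simp: abs_Jacobi_symbol abs_mult\<close>)

lemma monic_map_poly_factorization:
  assumes "monic (b :: 'a::field poly)"
  shows "map_poly to_ac b = (\<Prod>y\<in>#proots (map_poly to_ac b). [:- y, 1:])"
    and "size (proots (map_poly to_ac b)) = degree b"
proof -
  let ?B = "map_poly to_ac b"
  have "?B \<noteq> 0" using assms by (auto simp: map_poly_to_ac_eq_0_iff)
  then obtain A where A: "size A = degree ?B" "?B = smult (lead_coeff ?B) (\<Prod>x\<in>#A. [:- x, 1:])"
    using alg_closed_imp_factorization by blast
  have "lead_coeff ?B = 1" using assms by (simp add: degree_map_poly_to_ac coeff_map_poly)
  then have B: "?B = (\<Prod>x\<in>#A. [:- x, 1:])" using A by simp
  have "proots (\<Prod>x\<in>#A. [:- x, 1:]) = A"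
  proof (induction A)
    case (add x A)
    have "(\<Prod>x\<in>#A. [:- x, 1:]) \<noteq> 0" by (auto simp: prod_mset_zero_iff)
    then have "proots ([:- x, 1:] * (\<Prod>x\<in>#A. [:- x, 1:])) = proots [:- x, 1:] + proots (\<Prod>x\<in>#A. [:- x, 1:])"
      by (intro proots_mult no_zero_divisors) auto
    then show ?case using add by (simp del: mult_pCons_left)
  qed simp
  then have pr: "proots ?B = A" by (simp add: B)
  show "?B = (\<Prod>y\<in>#proots ?B. [:- y, 1:])" unfolding pr by (rule B)
  show "size (proots ?B) = degree b" unfolding pr A(1) by (rule degree_map_poly_to_ac)
qed

text \<open>Up to sign, both symbols are powers of the resultant \<open>\<Prod>\<^sub>x \<Prod>\<^sub>y (x - y)\<close> over the roots of
  \<open>a\<close> and \<open>b\<close>.\<close>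

lemma Jacobi_symbol_reciprocity:
  fixes b :: "'a::{field,finite} poly"
  assumes odd: "odd CARD('a)" and b: "monic b" and c: "c \<noteq> 0"
  obtains s :: int where
    "\<And>a. monic a \<Longrightarrow> degree a = n \<Longrightarrow> Jacobi_symbol (smult c b) a = s * Jacobi_symbol a b"
proof -
  let ?h = "(CARD('a) - 1) div 2"
  have "2 * ?h = CARD('a) - 1" using odd by simp
  then have "(c ^ ?h) ^ 2 = c ^ (CARD('a) - 1)" by (simp add: mult.commute flip: power_mult)
  also have "\<dots> = 1" using c by (intro power_card_eq_1) auto
  finally have ch: "c ^ ?h = 1 \<or> c ^ ?h = - 1" by (simp add: power2_eq_1_iff)
  \<comment> \<open>The quadratic character of the constant \<open>c\<close>, which enters once for
    each of the \<open>n\<close> roots of \<open>a\<close>.\<close>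
  define e :: int where "e = (if c ^ ?h = 1 then 1 else - 1)"
  have e: "of_int e = to_ac (c ^ ?h)" using ch by (auto simp: e_def simp del: to_ac_power)
  \<comment> \<open>The power of \<open>-1\<close> comes from turning \<open>x - y\<close> into
    \<open>y - x\<close> for all \<open>n * degree b\<close> pairs of roots. Only the degree of
    \<open>a\<close> enters.\<close>
  define s where "s = e ^ n * (- 1) ^ (?h * degree b * n)"
  have abs_s: "\<bar>s\<bar> = 1" by (simp add: s_def e_def abs_mult power_abs)
  have "Jacobi_symbol (smult c b) a = s * Jacobi_symbol a b" if a: "monic a" "degree a = n" for a
  proof (rule of_int_alg_closure_inject[OF odd])
    let ?A = "proots (map_poly to_ac a)" and ?B = "proots (map_poly to_ac b)"
    have poly_eq: "ac_eval x p = (\<Prod>y\<in>#proots (map_poly to_ac p). x - y)" if "monic p" for x and p :: "'a poly"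
      unfolding ac_eval_def
      by (subst monic_map_poly_factorization(1)[OF that])
        (simp add: poly_prod_mset image_mset.compositionality comp_def)
    have sizes: "size ?A = n" "size ?B = degree b"
      using monic_map_poly_factorization(2) a b by auto
    have "of_int (Jacobi_symbol (smult c b) a) = (\<Prod>x\<in>#?A. to_ac c ^ ?h * ac_eval x b ^ ?h)"
      by (simp add: Jacobi_symbol_eq_prod_roots[OF odd a(1)] ac_eval_def map_poly_smult power_mult_distrib)
    also have "\<dots> = of_int e ^ n * (\<Prod>x\<in>#?A. \<Prod>y\<in>#?B. (x - y) ^ ?h)"
      by (simp add: prod_mset.distrib e sizes poly_eq[OF b] prod_mset_power)
    also have "(\<Prod>x\<in>#?A. \<Prod>y\<in>#?B. (x - y) ^ ?h) = (\<Prod>y\<in>#?B. \<Prod>x\<in>#?A. (x - y) ^ ?h)"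
      by (rule prod_mset.swap)
    also have "\<dots> = (\<Prod>y\<in>#?B. \<Prod>x\<in>#?A. (- 1) ^ ?h * (y - x) ^ ?h)"
      by (simp flip: power_mult_distrib)
    also have "\<dots> = (- 1) ^ (?h * degree b * n) * (\<Prod>y\<in>#?B. ac_eval y a ^ ?h)"
      by (simp add: prod_mset.distrib sizes poly_eq[OF a(1)] prod_mset_power mult_ac flip: power_mult)
    also have "(\<Prod>y\<in>#?B. ac_eval y a ^ ?h) = of_int (Jacobi_symbol a b)"
      by (simp add: Jacobi_symbol_eq_prod_roots[OF odd b])
    finally show "of_int (Jacobi_symbol (smult c b) a) = (of_int (s * Jacobi_symbol a b) :: 'a alg_closure)"
      by (simp add: s_def mult.assoc)
  qed (use a b in \<open>auto simp: abs_Jacobi_symbol abs_mult abs_s\<close>)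
  then show ?thesis using that by blast
qed

section \<open>Characters from Jacobi symbols\<close>

lemma Jacobi_symbol_1_left:
  assumes "odd CARD('a::{field,finite})" "monic (a :: 'a poly)" shows "Jacobi_symbol 1 a = 1"
proof -
  have "\<bar>Jacobi_symbol 1 a\<bar> = 1" using assms by (simp add: abs_Jacobi_symbol)
  moreover have "Jacobi_symbol 1 a = Jacobi_symbol 1 a * Jacobi_symbol 1 a"
    using Jacobi_symbol_mult_left[OF assms, of 1 1] by simp
  ultimately show ?thesis by auto
qed

text \<open>The prime \<open>p\<close> of odd multiplicity in \<open>a\<close> makes the character nontrivial.\<close>

lemma real_character_Jacobi_symbol:
  fixes a D :: "'a::{field,finite} poly"
  assumes odd: "odd CARD('a)" and a: "monic a" and p: "monic p" "irreducible p"
    and apa: "a = p ^ j * a'" "odd j" "\<not> p dvd a'" and D: "D \<noteq> 0"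
  shows "real_character (a * D) (\<lambda>x. of_int (Jacobi_symbol x a) * of_bool (coprime x D))"
proof
  have a0: "a \<noteq> 0" using a by auto
  have "a = p * (p ^ (j - 1) * a')" using apa by (cases j) (simp_all add: mult.assoc)
  then have "p dvd a" by (metis dvd_triv_left)
  then have "degree p \<le> degree a" using a0 by (intro dvd_imp_degree_le)
  then show "0 < degree (a * D)" using irreducible_degree_pos[OF p(2)] a0 D by (simp add: degree_mult_eq)
  show "of_int (Jacobi_symbol (x * y) a) * of_bool (coprime (x * y) D) =
      of_int (Jacobi_symbol x a) * of_bool (coprime x D) * (of_int (Jacobi_symbol y a) * of_bool (coprime y D) :: real)" for x y
    by (simp add: Jacobi_symbol_mult_left[OF odd a] coprime_poly_mult_left_iff)
  have per: "N dvd x mod (a * D) - x" if "N dvd a * D" for N x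
    by (rule dvd_trans[OF that]) (metis mod_eq_dvd_iff mod_mod_trivial)
  show "of_int (Jacobi_symbol (x mod (a * D)) a) * of_bool (coprime (x mod (a * D)) D) =
      (of_int (Jacobi_symbol x a) * of_bool (coprime x D) :: real)" for x
    using Jacobi_symbol_cong[OF per[of a x]] coprime_poly_cong[OF per[of D x]] by simp
  have abs: "\<bar>of_int (Jacobi_symbol x a) :: real\<bar> = of_bool (coprime x a)" for x
    using abs_Jacobi_symbol[OF a, of x] by (metis of_int_abs of_int_of_bool)
  show "\<not> coprime x (a * D) \<Longrightarrow> of_int (Jacobi_symbol x a) * of_bool (coprime x D) = (0 :: real)" for x
    using abs[of x] by (auto simp: coprime_poly_mult_right_iff)
  show "coprime x (a * D) \<Longrightarrow> \<bar>of_int (Jacobi_symbol x a) * of_bool (coprime x D)\<bar> = (1 :: real)" for x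
    using abs[of x] by (auto simp: coprime_poly_mult_right_iff)
  obtain \<alpha> where "irreducible_root p \<alpha>" using p exists_irreducible_root by blast
  then obtain r where r: "Legendre_symbol r p = - 1" using irreducible_root.exists_nonresidue odd by blast
  have aD: "a * D \<noteq> 0" using a0 D by simp
  \<comment> \<open>\<open>W\<close> carries all primes of \<open>a * D\<close> other than
    \<open>p\<close>. A nonresidue modulo \<open>p\<close> that is 1 modulo \<open>W\<close> is
    coprime to \<open>D\<close>, and only the factor \<open>p ^ j\<close> affects its symbol;
    \<open>j\<close> is odd, so the symbol is \<open>-1\<close>.\<close>
  obtain W where W: "a * D = p ^ multiplicity_poly p (a * D) * W" "\<not> p dvd W"
    using multiplicity_decomposition[OF p(2) aD] by blast
  let ?i = "multiplicity_poly p (a * D)"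
  obtain u where u: "p dvd u - r" "W dvd u - 1"
    using chinese_remainder_poly irreducible_imp_coprime_poly[OF p(2) W(2)] by blast
  have "coprime (p ^ n) a'" for n
    by (induction n) (simp_all add: coprime_poly_mult_left_iff irreducible_imp_coprime_poly[OF p(2) apa(3)])
  moreover have "a' dvd a * D" by (simp add: apa(1))
  then have "a' dvd p ^ ?i * W" unfolding W(1)[symmetric] .
  ultimately have "a' dvd W" using coprime_poly_dvd_mult by (metis coprime_commute)
  then have "a' dvd u - 1" using u dvd_trans by blast
  have "monic a'" using a apa p monic_mult_cancel monic_power by metis
  then have "Jacobi_symbol u a' = 1"
    using Jacobi_symbol_cong[OF \<open>a' dvd u - 1\<close>] Jacobi_symbol_1_left[OF odd] by simp
  moreover have "Legendre_symbol u p = - 1" using Legendre_symbol_cong[OF u(1)] r by simp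
  moreover have "a' \<noteq> 0" "p \<noteq> 0" using apa a0 p by auto
  ultimately have J: "Jacobi_symbol u a = - 1" unfolding apa(1)
    using p apa(2) by (simp add: Jacobi_symbol_mult_right Jacobi_symbol_power_right Jacobi_symbol_prime)
  have "\<not> (s dvd u \<and> s dvd D)" if s: "monic s" "irreducible s" for s
  proof
    assume sd: "s dvd u \<and> s dvd D"
    then have "s dvd p ^ ?i * W" using W(1) by (metis dvd_mult)
    then consider "s dvd p ^ ?i" | "s dvd W" using s irreducible_dvd_mult_iff by blast
    then show False
    proof cases
      case 1
      then have "s = p" using s p irreducible_dvd_power monic_irreducible_dvd_eq by blast
      then have "p dvd r" using sd u(1) by (metis dvd_diff_right_iff dvd_diff_left_iff)
      then show False using r by (simp add: Legendre_symbol_def)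
    next
      case 2
      then have "s dvd u - 1" using u(2) dvd_trans by blast
      then have "s dvd 1" using sd by (metis dvd_diff_right_iff)
      then show False using s irreducible_not_unit by blast
    qed
  qed
  then have "coprime u D" using D by (subst coprime_poly_iff_no_common_irreducible) auto
  then show "\<exists>u. of_int (Jacobi_symbol u a) * of_bool (coprime u D) = (- 1 :: real)"
    using J by (intro exI[of _ u]) simp
qed

text \<open>Reciprocity, with its sign constant in degree \<open>n\<close>, turns this into the sum
  of a character modulo the monic multiple of \<open>b\<close> over a translate of
  \<open>deg_less n\<close>, a union of complete residue systems. The simple prime factor
  \<open>p\<close> makes the character nontrivial.\<close>

lemma sum_Jacobi_symbol_eq_0:
  fixes b :: "'a::{field,finite} poly"
  assumes odd: "odd CARD('a)" and p: "monic p" "irreducible p" "p dvd b" "\<not> p\<^sup>2 dvd b"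
    and n: "n \<ge> degree b"
  shows "(\<Sum>a | monic a \<and> degree a = n. Jacobi_symbol b a) = 0"
proof -
  have b0: "b \<noteq> 0" using p by auto
  define c where "c = lead_coeff b"
  define b' where "b' = smult (inverse c) b"
  have c: "c \<noteq> 0" "monic b'" "b = smult c b'" "degree b' = degree b"
    using b0 by (simp_all add: c_def b'_def)
  have "p dvd b'" unfolding b'_def by (rule dvd_smult[OF p(3)])
  then obtain b'' where b'': "b' = p * b''" by (rule dvdE)
  have "\<not> p dvd b''"
  proof
    assume "p dvd b''"
    then have "p * p dvd b'" unfolding b'' by (rule mult_dvd_mono[OF dvd_refl])
    then show False using p(4) c(3) dvd_smult by (metis power2_eq_square)
  qed
  then interpret real_character "b' * 1" "\<lambda>x. of_int (Jacobi_symbol x b') * of_bool (coprime x 1)"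
    using b'' by (intro real_character_Jacobi_symbol[OF odd c(2) p(1,2), of 1 b'']) simp_all
  obtain s where s: "\<And>a. monic a \<Longrightarrow> degree a = n \<Longrightarrow> Jacobi_symbol (smult c b') a = s * Jacobi_symbol a b'"
    using Jacobi_symbol_reciprocity[OF odd c(2,1)] by blast
  have "(\<Sum>a | monic a \<and> degree a = n. Jacobi_symbol b a) =
      (\<Sum>a | monic a \<and> degree a = n. s * Jacobi_symbol a b')"
    by (intro sum.cong refl) (use s c(3) in auto)
  also have "\<dots> = s * (\<Sum>x\<in>deg_less n. Jacobi_symbol (monom 1 n + x) b')"
    by (simp add: monic_degree_eq_image sum.reindex sum_distrib_left)
  also have "(\<Sum>x\<in>deg_less n. Jacobi_symbol (monom 1 n + x) b') = 0"
    using sum_deg_less_eq_0[of n "monom 1 n"] n by (simp add: c(4) flip: of_int_sum)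
  finally show ?thesis by simp
qed

section \<open>The value \<open>L(1, \<chi>)\<close> as a finite sum\<close>

lemma of_nat_powr_minus:
  "k > 0 \<Longrightarrow> of_nat k powr (- of_nat s) = complex_of_real (inverse (real k ^ s))"
  by (simp add: powr_minus powr_nat')

lemma L_poly_1_eq:
  fixes b :: "'a::{field,finite} poly"
  assumes odd: "odd CARD('a)" and p: "monic p" "irreducible p" "p dvd b" "\<not> p\<^sup>2 dvd b"
  shows "L_poly 1 b = complex_of_real (\<Sum>n<degree b. inverse (real CARD('a) ^ n) *
    (\<Sum>a | monic a \<and> degree a = n. of_int (Jacobi_symbol b a)))"
proof -
  have eq: "(\<Sum>a | monic a \<and> degree a = n. of_int (Jacobi_symbol b a) * of_nat (norm_poly a) powr (- 1)) =
      complex_of_real (inverse (real CARD('a) ^ n) * of_int (\<Sum>a | monic a \<and> degree a = n. Jacobi_symbol b a))" for n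
  proof -
    have "of_nat (norm_poly a) powr (- 1) = complex_of_real (inverse (real CARD('a) ^ n))"
      if "degree a = n" for a :: "'a poly"
      using of_nat_powr_minus[of "norm_poly a" 1] that by (simp add: norm_poly_def)
    then show ?thesis by (simp add: sum_distrib_left mult.commute)
  qed
  have "L_poly 1 b = (\<Sum>n<degree b. complex_of_real (inverse (real CARD('a) ^ n) *
      of_int (\<Sum>a | monic a \<and> degree a = n. Jacobi_symbol b a)))"
    unfolding L_poly_def eq
  proof (rule suminf_finite)
    fix n assume "n \<notin> {..<degree b}"
    then have "(\<Sum>a | monic a \<and> degree a = n. Jacobi_symbol b a) = 0"
      by (intro sum_Jacobi_symbol_eq_0[OF odd p]) auto
    then show "complex_of_real (inverse (real CARD('a) ^ n) *
      of_int (\<Sum>a | monic a \<and> degree a = n. Jacobi_symbol b a)) = 0" by simp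
  qed simp
  then show ?thesis by simp
qed

lemma monic_square_or_odd_prime_power:
  assumes "monic (a :: 'a::{field,finite} poly)"
  obtains b where "monic b" "a = b\<^sup>2"
  | p j a' where "monic p" "irreducible p" "a = p ^ j * a'" "odd j" "\<not> p dvd a'"
proof (cases "\<forall>p. monic p \<and> irreducible p \<longrightarrow> even (multiplicity_poly p a)")
  case False
  then obtain p where p: "monic p" "irreducible p" "odd (multiplicity_poly p a)" by auto
  obtain a' where "a = p ^ multiplicity_poly p a * a'" "\<not> p dvd a'"
    using multiplicity_decomposition p(2) monic_nonzero[OF assms] by blast
  then show ?thesis using p that(2) by blast
next
  case True
  have "\<exists>b. monic b \<and> a = b\<^sup>2"
    using assms True
  proof (induction "degree a" arbitrary: a rule: less_induct)
    case less
    show ?case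
    proof (cases "degree a = 0")
      case True
      then have "a = 1" using less.prems(1) monic_unit[of a] monic_nonzero[of a] by (simp add: is_unit_poly_iff_degree)
      then show ?thesis by (intro exI[of _ 1]) simp
    next
      case False
      have a0: "a \<noteq> 0" using less.prems by auto
      with False obtain p where p: "monic p" "irreducible p" "p dvd a"
        by (metis exists_monic_irreducible_dvd gr0I)
      have "1 \<le> multiplicity_poly p a" using power_dvd_iff_multiplicity[OF p(2) a0, of 1] p by simp
      moreover have "even (multiplicity_poly p a)" using less.prems p by blast
      ultimately have "2 \<le> multiplicity_poly p a" by presburger
      then obtain c where c: "a = p\<^sup>2 * c" using power_dvd_iff_multiplicity[OF p(2) a0, of 2] by auto
      then have nz: "p \<noteq> 0" "c \<noteq> 0" using a0 by auto
      have "monic c" using c less.prems(1) p(1) monic_mult_cancel monic_power by metis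
      moreover have "degree c < degree a"
        using c nz irreducible_degree_pos[OF p(2)] by (simp add: degree_mult_eq degree_power_eq)
      moreover have "even (multiplicity_poly r c)" if "monic r" "irreducible r" for r
      proof -
        have "multiplicity_poly r a = 2 * multiplicity_poly r p + multiplicity_poly r c"
          using that nz by (simp add: c multiplicity_mult power2_eq_square)
        then show ?thesis using less.prems(2) that by (metis dvd_triv_left dvd_add_right_iff)
      qed
      ultimately obtain d where "monic d" "c = d\<^sup>2" using less.hyps[of c] by auto
      then show ?thesis using p c by (intro exI[of _ "p * d"]) (simp add: monic_mult power_mult_distrib)
    qed
  qed
  then show ?thesis using that(1) by blast
qed

section \<open>Totients and zeta functions\<close>

definition coprime_monics :: "'a::{field,finite} poly \<Rightarrow> nat \<Rightarrow> 'a poly set"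
  where "coprime_monics D k = {b. monic b \<and> degree b = k \<and> coprime b D}"

lemma finite_coprime_monics [simp, intro]: "finite (coprime_monics D k)"
  by (rule finite_subset[OF _ finite_monic_degree[of k]]) (auto simp: coprime_monics_def)

lemma card_coprime_monics_le: "card (coprime_monics (D :: 'a::{field,finite} poly) k) \<le> CARD('a) ^ k"
  unfolding card_monic_degree[symmetric] by (rule card_mono) (auto simp: coprime_monics_def)

lemma card_deg_less_coprime:
  assumes "(D :: 'a::{field,finite} poly) \<noteq> 0" "degree D \<le> k"
  shows "card {x \<in> deg_less k. coprime (c + x) D} = CARD('a) ^ (k - degree D) * phi_poly D"
proof -
  have "card {x \<in> deg_less k. coprime (c + x) D} = (\<Sum>x\<in>deg_less k. of_bool (coprime (c + x) D))"
    by (simp add: sum_of_bool_eq Int_def)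
  also have "\<dots> = of_nat CARD('a) ^ (k - degree D) * (\<Sum>x\<in>deg_less (degree D). of_bool (coprime x D))"
    by (rule sum_deg_less_periodic[OF assms]) simp
  finally show ?thesis by (simp add: sum_of_bool_eq Int_def phi_poly_def)
qed

lemma card_coprime_monics:
  assumes "(D :: 'a::{field,finite} poly) \<noteq> 0" "degree D \<le> k"
  shows "card (coprime_monics D k) = CARD('a) ^ (k - degree D) * phi_poly D"
proof -
  have "coprime_monics D k = {b. monic b \<and> degree b = k} \<inter> {b. coprime b D}"
    by (auto simp: coprime_monics_def)
  also have "\<dots> = (\<lambda>x. monom 1 k + x) ` {x \<in> deg_less k. coprime (monom 1 k + x) D}"
    by (auto simp: monic_degree_eq_image)
  finally show ?thesis using assms by (simp add: card_image card_deg_less_coprime)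
qed

text \<open>All leading coefficients are allowed: the counts below degrees \<open>l + 1\<close> and
  \<open>l\<close> differ by the factor \<open>q - 1\<close>.\<close>

lemma card_coprime_degree_eq:
  assumes "(D :: 'a::{field,finite} poly) \<noteq> 0" "degree D \<le> l"
  shows "real (card {m. m \<noteq> 0 \<and> degree m = l \<and> coprime m D}) =
    (real CARD('a) - 1) * real CARD('a) ^ (l - degree D) * real (phi_poly D)"
proof -
  have "{m. m \<noteq> 0 \<and> degree m = l \<and> coprime m D} =
      {x \<in> deg_less (Suc l). coprime x D} - {x \<in> deg_less l. coprime x D}"
    using degree_eq_conv_deg_less[of l, where 'a='a] by auto
  moreover have "{x \<in> deg_less l. coprime x D} \<subseteq> {x \<in> deg_less (Suc l). coprime x D}"
    using deg_less_mono[of l "Suc l"] by auto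
  ultimately have "real (card {m. m \<noteq> 0 \<and> degree m = l \<and> coprime m D}) =
      real (card {x \<in> deg_less (Suc l). coprime x D}) - real (card {x \<in> deg_less l. coprime x D})"
    by (simp add: card_Diff_subset of_nat_diff card_mono)
  also have "\<dots> = real CARD('a) ^ (Suc l - degree D) * real (phi_poly D)
      - real CARD('a) ^ (l - degree D) * real (phi_poly D)"
    using card_deg_less_coprime[OF assms(1), of l 0] card_deg_less_coprime[OF assms(1), of "Suc l" 0] assms(2)
    by simp
  finally show ?thesis using assms(2) by (simp add: Suc_diff_le algebra_simps)
qed

lemma card_coprime_degree_le:
  "real (card {m::'a::{field,finite} poly. m \<noteq> 0 \<and> degree m = l \<and> coprime m D}) \<le> real CARD('a) ^ Suc l"
proof -
  have "card {m::'a poly. m \<noteq> 0 \<and> degree m = l \<and> coprime m D} \<le> card (deg_less (Suc l) :: 'a poly set)"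
    by (rule card_mono) (auto simp: deg_less_iff)
  then show ?thesis by (simp add: card_deg_less flip: of_nat_power of_nat_mult)
qed

section \<open>Totient identities\<close>

lemma phi_poly_mult:
  assumes "coprime (a :: 'a::{field,finite} poly) b" "a \<noteq> 0" "b \<noteq> 0"
  shows "phi_poly (a * b) = phi_poly a * phi_poly b"
proof -
  let ?R = "\<lambda>N. {x \<in> deg_less (degree N). coprime x N} :: 'a poly set"
  have "bij_betw (\<lambda>x. (x mod a, x mod b)) (?R (a * b)) (?R a \<times> ?R b)"
  proof (rule bij_betw_imageI)
    show "inj_on (\<lambda>x. (x mod a, x mod b)) (?R (a * b))"
    proof (rule inj_onI)
      fix x y assume xy: "x \<in> ?R (a * b)" "y \<in> ?R (a * b)" "(x mod a, x mod b) = (y mod a, y mod b)"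
      then have "a dvd x - y" "b dvd x - y" by (simp_all add: mod_eq_dvd_iff)
      then have "a * b dvd x - y" using assms(1) coprime_poly_mult_dvd by blast
      then have "x mod (a * b) = y mod (a * b)" by (simp add: mod_eq_dvd_iff)
      then show "x = y" using xy mod_deg_less[of _ "a * b"] by simp
    qed
    show "(\<lambda>x. (x mod a, x mod b)) ` ?R (a * b) = ?R a \<times> ?R b"
    proof (intro equalityI subsetI)
      fix z assume "z \<in> ?R a \<times> ?R b"
      then obtain u v where z: "z = (u, v)" "u \<in> ?R a" "v \<in> ?R b" by auto
      obtain x where x: "a dvd x - u" "b dvd x - v" using chinese_remainder_poly assms(1) by blast
      let ?x = "x mod (a * b)"
      have "a * b dvd ?x - x" by (metis mod_eq_dvd_iff mod_mod_trivial)
      then have d: "a dvd ?x - x" "b dvd ?x - x" by (auto intro: dvd_trans[rotated])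
      have du: "a dvd ?x - u" using dvd_add[OF d(1) x(1)] by simp
      have dv: "b dvd ?x - v" using dvd_add[OF d(2) x(2)] by simp
      have "coprime ?x a" "coprime ?x b" using coprime_poly_cong[OF du] coprime_poly_cong[OF dv] z by auto
      then have "?x \<in> ?R (a * b)" using assms by (simp add: mod_in_deg_less coprime_poly_mult_right_iff)
      moreover have "?x mod a = u" "?x mod b = v"
        using du dv z mod_deg_less by (metis (no_types, lifting) mem_Collect_eq mod_eq_dvd_iff)+
      ultimately show "z \<in> (\<lambda>x. (x mod a, x mod b)) ` ?R (a * b)" using z by force
    qed (use assms in \<open>auto simp: mod_in_deg_less coprime_poly_mult_right_iff\<close>)
  qed
  then show ?thesis unfolding phi_poly_def using bij_betw_same_card by (fastforce simp: card_cartesian_product)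
qed

text \<open>Reduction of the fraction \<open>r / N\<close> to lowest terms, cancelling one common
  prime at a time.\<close>

lemma gcd_decomposition_poly:
  assumes "(N :: 'a::field poly) \<noteq> 0"
  obtains g r' N' where "monic g" "r = g * r'" "N = g * N'" "coprime r' N'"
proof -
  have "\<exists>g r' N'. monic g \<and> r = g * r' \<and> N = g * N' \<and> coprime r' N'"
    using assms
  proof (induction "degree N" arbitrary: N r rule: less_induct)
    case less
    show ?case
    proof (cases "coprime r N")
      case True
      then show ?thesis by (intro exI[of _ 1] exI[of _ r] exI[of _ N]) simp
    next
      case False
      then obtain p where p: "monic p" "irreducible p" "p dvd r" "p dvd N"
        using coprime_poly_iff_no_common_irreducible less.prems by blast
      obtain r1 N1 where 1: "r = p * r1" "N = p * N1" using p by (auto elim!: dvdE)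
      have "N1 \<noteq> 0" "degree N1 < degree N"
        using 1 less.prems irreducible_degree_pos[OF p(2)] by (auto simp: degree_mult_eq)
      with less.hyps obtain g r' N' where "monic g" "r1 = g * r'" "N1 = g * N'" "coprime r' N'" by blast
      then show ?thesis using p 1
        by (intro exI[of _ "p * g"] exI[of _ r'] exI[of _ N']) (simp add: monic_mult mult.assoc)
    qed
  qed
  then show ?thesis using that by blast
qed

text \<open>Residues modulo \<open>N\<close> correspond to reduced fractions \<open>x / e\<close> with \<open>e\<close> dividing \<open>N\<close>.\<close>

lemma sum_phi_poly_divisors:
  assumes "monic (N :: 'a::{field,finite} poly)"
  shows "(\<Sum>e | monic e \<and> e dvd N. phi_poly e) = CARD('a) ^ degree N"
proof -
  let ?E = "{e. monic e \<and> e dvd N}" and ?R = "\<lambda>e. {x \<in> deg_less (degree e). coprime x e} :: 'a poly set"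
  have N0: "N \<noteq> 0" using assms by auto
  have fin: "finite ?E"
    by (rule finite_subset[of _ "deg_less (Suc (degree N))"])
      (use N0 in \<open>auto simp: deg_less_iff less_Suc_eq_le dvd_imp_degree_le\<close>)
  have nz: "e \<noteq> 0" "N div e \<noteq> 0" "N div e * e = N" if "e \<in> ?E" for e
    using that N0 by (auto simp: dvd_div_eq_0_iff)
  \<comment> \<open>\<open>N div e * x\<close> is the numerator of \<open>x / e\<close> over the
    common denominator \<open>N\<close>; injectivity is cross-multiplication.\<close>
  have "bij_betw (\<lambda>(e, x). N div e * x) (Sigma ?E ?R) (deg_less (degree N))"
  proof (rule bij_betw_imageI)
    show "inj_on (\<lambda>(e, x). N div e * x) (Sigma ?E ?R)"
    proof (rule inj_onI)
      fix s t assume st: "s \<in> Sigma ?E ?R" "t \<in> Sigma ?E ?R" "(\<lambda>(e, x). N div e * x) s = (\<lambda>(e, x). N div e * x) t"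
      obtain e x where s: "s = (e, x)" "e \<in> ?E" "x \<in> ?R e" using st(1) by auto
      obtain f y where t: "t = (f, y)" "f \<in> ?E" "y \<in> ?R f" using st(2) by auto
      have eq: "N div e * x = N div f * y" using st(3) s t by simp
      have "N * (x * f) = (N div e * e) * (x * f)" using nz[OF s(2)] by simp
      also have "\<dots> = (N div e * x) * (e * f)" by (simp add: mult_ac)
      also have "\<dots> = (N div f * y) * (e * f)" by (simp only: eq)
      also have "\<dots> = (N div f * f) * (y * e)" by (simp only: mult_ac)
      also have "\<dots> = N * (y * e)" using nz[OF t(2)] by simp
      finally have xf: "x * f = y * e" using N0 by simp
      have "e dvd x * f" unfolding xf by simp
      then have "e dvd f" using s(3) coprime_poly_dvd_mult by (metis (no_types, lifting) coprime_commute mem_Collect_eq)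
      moreover have "f dvd y * e" unfolding xf[symmetric] by simp
      then have "f dvd e" using t(3) coprime_poly_dvd_mult by (metis (no_types, lifting) coprime_commute mem_Collect_eq)
      ultimately have "e = f" using s t monic_dvd_antisym by blast
      moreover have "x = y" using xf nz[OF s(2)] \<open>e = f\<close> by simp
      ultimately show "s = t" using s t by simp
    qed
    show "(\<lambda>(e, x). N div e * x) ` Sigma ?E ?R = deg_less (degree N)"
    proof (intro equalityI subsetI)
      fix z assume "z \<in> (\<lambda>(e, x). N div e * x) ` Sigma ?E ?R"
      then obtain e x where ex: "e \<in> ?E" "x \<in> ?R e" "z = N div e * x" by auto
      have "degree N = degree (N div e) + degree e"
        using nz[OF ex(1)] degree_mult_eq[of "N div e" e] by simp
      then show "z \<in> deg_less (degree N)"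
        using ex nz[OF ex(1)] by (cases "x = 0") (auto simp: deg_less_iff degree_mult_eq)
    next
      fix z :: "'a poly" assume z: "z \<in> deg_less (degree N)"
      obtain g x e where g: "monic g" "z = g * x" "N = g * e" "coprime x e"
        using gcd_decomposition_poly[OF N0] by blast
      have e: "monic e" using g assms monic_mult_cancel by blast
      have "e \<noteq> 0" "g \<noteq> 0" using e g by auto
      then have "N div e = g" using g by simp
      moreover have "x \<in> deg_less (degree e)"
        using z g \<open>e \<noteq> 0\<close> \<open>g \<noteq> 0\<close> by (cases "x = 0") (auto simp: deg_less_iff degree_mult_eq)
      ultimately show "z \<in> (\<lambda>(e, x). N div e * x) ` Sigma ?E ?R"
        using e g by (intro image_eqI[of _ _ "(e, x)"]) auto
    qed
  qed
  then have "card (Sigma ?E ?R) = CARD('a) ^ degree N"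
    by (simp add: bij_betw_same_card card_deg_less)
  then show ?thesis unfolding phi_poly_def using fin by (subst (asm) card_SigmaI) auto
qed

text \<open>The part of degree \<open>k\<close> of \<open>\<phi> * 1 = |.|\<close>, restricted to
  monics coprime to \<open>D\<close>: factorizations \<open>b = e c\<close> are sorted by the degree
  of \<open>e\<close>, and coprimality to \<open>D\<close> passes to both factors.\<close>

lemma phi_poly_convolution:
  "(\<Sum>i\<le>k. (\<Sum>e\<in>coprime_monics D i. phi_poly e) * card (coprime_monics D (k - i))) =
    CARD('a) ^ k * card (coprime_monics (D :: 'a::{field,finite} poly) k)"
proof -
  let ?B = "coprime_monics D"
  have "CARD('a) ^ k * card (?B k) = (\<Sum>b\<in>?B k. \<Sum>e | monic e \<and> e dvd b. phi_poly e)"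
  proof -
    have "(\<Sum>e | monic e \<and> e dvd b. phi_poly e) = CARD('a) ^ k" if "b \<in> ?B k" for b
      using that sum_phi_poly_divisors[of b] by (auto simp: coprime_monics_def)
    then show ?thesis by simp
  qed
  also have "\<dots> = (\<Sum>(b, e)\<in>(SIGMA b:?B k. {e. monic e \<and> e dvd b}). phi_poly e)"
  proof (rule sum.Sigma)
    show "\<forall>b\<in>?B k. finite {e. monic e \<and> e dvd b}"
    proof
      fix b assume "b \<in> ?B k"
      then have "b \<noteq> 0" by (auto simp: coprime_monics_def)
      then have "{e. monic e \<and> e dvd b} \<subseteq> deg_less (Suc (degree b))"
        by (auto simp: deg_less_iff less_Suc_eq_le dvd_imp_degree_le)
      then show "finite {e. monic e \<and> e dvd b}" by (rule finite_subset) simp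
    qed
  qed simp
  also have "\<dots> = (\<Sum>(i, e, c)\<in>(SIGMA i:{..k}. ?B i \<times> ?B (k - i)). phi_poly e)"
  proof (rule sum.reindex_bij_witness[of _ "\<lambda>(i, e, c). (e * c, e)" "\<lambda>(b, e). (degree e, e, b div e)"])
    fix t assume "t \<in> (SIGMA b:?B k. {e. monic e \<and> e dvd b})"
    then obtain e c where t: "t = (e * c, e)" "monic e" "monic (e * c)" "degree (e * c) = k" "coprime (e * c) D"
      by (auto simp: coprime_monics_def elim!: dvdE)
    have c: "monic c" using t monic_mult_cancel by blast
    then have "e \<noteq> 0" "c \<noteq> 0" using t by auto
    then show "(\<lambda>(i, e, c). (e * c, e)) ((\<lambda>(b, e). (degree e, e, b div e)) t) = t"
      "(\<lambda>(b, e). (degree e, e, b div e)) t \<in> (SIGMA i:{..k}. ?B i \<times> ?B (k - i))"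
      using t c by (auto simp: coprime_monics_def degree_mult_eq coprime_poly_mult_left_iff)
  next
    fix t assume "t \<in> (SIGMA i:{..k}. ?B i \<times> ?B (k - i))"
    then obtain i e c where t: "t = (i, e, c)" "i \<le> k" "e \<in> ?B i" "c \<in> ?B (k - i)" by auto
    then have ec: "e \<noteq> 0" "c \<noteq> 0" "monic e" "monic c" by (auto simp: coprime_monics_def)
    have "degree (e * c) = k" using t ec by (simp add: coprime_monics_def degree_mult_eq)
    moreover have "monic (e * c)" using ec(3,4) by (rule monic_mult)
    ultimately have "e * c \<in> ?B k" using t by (auto simp: coprime_monics_def coprime_poly_mult_left_iff)
    then show "(\<lambda>(b, e). (degree e, e, b div e)) ((\<lambda>(i, e, c). (e * c, e)) t) = t"
      "(\<lambda>(i, e, c). (e * c, e)) t \<in> (SIGMA b:?B k. {e. monic e \<and> e dvd b})"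
      using t ec by (auto simp: coprime_monics_def)
  qed auto
  also have "\<dots> = (\<Sum>i\<le>k. \<Sum>(e, c)\<in>?B i \<times> ?B (k - i). phi_poly e)"
    by (subst sum.Sigma) auto
  also have "\<dots> = (\<Sum>i\<le>k. (\<Sum>e\<in>?B i. phi_poly e) * card (?B (k - i)))"
    by (simp add: sum.cartesian_product[symmetric] sum_distrib_right mult.commute)
  finally show ?thesis by simp
qed

text \<open>\<open>M\<^sub>D(s)\<close> as a polynomial in \<open>u = q\<^sup>-\<^sup>s\<close>.\<close>

definition M_euler :: "'a::{field,finite} poly \<Rightarrow> real \<Rightarrow> real"
  where "M_euler D u = (\<Sum>e | e dvd D \<and> monic e. of_int (moebius_poly e) * u ^ degree e)"

lemma M_poly_eq:
  "M_poly (D :: 'a::{field,finite} poly) (of_nat s) = complex_of_real (M_euler D (inverse (real CARD('a) ^ s)))"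
proof -
  have "of_nat (norm_poly e) powr (- of_nat s) = complex_of_real (inverse (real CARD('a) ^ s) ^ degree e)"
    for e :: "'a poly"
    by (subst of_nat_powr_minus) (simp_all add: norm_poly_def power_inverse mult.commute flip: power_mult)
  then show ?thesis by (simp add: M_poly_def M_euler_def)
qed

section \<open>Adjoining one prime factor to \<open>D\<close>\<close>

lemma M_euler_const:
  assumes "(D :: 'a::{field,finite} poly) \<noteq> 0" "degree D = 0" shows "M_euler D u = 1"
proof -
  have "is_unit D" using assms by (simp add: is_unit_poly_iff_degree)
  then have "{e. e dvd D \<and> monic e} = {1}" using monic_unit by (auto dest: dvd_unit_imp_unit unit_imp_dvd)
  then show ?thesis by (simp add: M_euler_def moebius_poly_def)
qed

lemma moebius_poly_prime_mult:
  assumes "monic p" "irreducible p" "\<not> p dvd e" "squarefree (p * e)" "(e :: 'a::{field,finite} poly) \<noteq> 0"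
  shows "moebius_poly (p * e) = - moebius_poly e"
proof -
  have "squarefree e" using assms(4) squarefree_multD by blast
  moreover have "monic_prime_divisors (p * e) = insert p (monic_prime_divisors e)"
    by (simp add: monic_prime_divisors_mult monic_prime_divisors_prime[OF assms(1,2)])
  moreover have "p \<notin> monic_prime_divisors e" using assms by (auto simp: monic_prime_divisors_def)
  ultimately show ?thesis using assms by (simp add: moebius_poly_def finite_monic_prime_divisors)
qed

text \<open>The divisors of \<open>p * D\<close> are those of \<open>D\<close> and their multiples
  by \<open>p\<close>, on which the Moebius function changes sign: one Euler factor.\<close>

lemma M_euler_prime_mult:
  assumes p: "monic p" "irreducible p" "\<not> p dvd D" and sf: "squarefree (p * D)"
    and D: "(D :: 'a::{field,finite} poly) \<noteq> 0"
  shows "M_euler (p * D) u = M_euler D u * (1 - u ^ degree p)"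
proof -
  let ?E = "{e. e dvd D \<and> monic e}"
  have fin: "finite ?E"
    by (rule finite_subset[of _ "deg_less (Suc (degree D))"])
      (use D in \<open>auto simp: deg_less_iff less_Suc_eq_le dvd_imp_degree_le\<close>)
  have np: "\<not> p dvd e" if "e \<in> ?E" for e using that p(3) dvd_trans by blast
  have p0: "p \<noteq> 0" using p by auto
  have "{e. e dvd p * D \<and> monic e} = ?E \<union> (*) p ` ?E"
  proof (intro equalityI subsetI)
    fix e assume e: "e \<in> {e. e dvd p * D \<and> monic e}"
    show "e \<in> ?E \<union> (*) p ` ?E"
    proof (cases "p dvd e")
      case True
      then obtain f where f: "e = p * f" by (rule dvdE)
      then have "f dvd D" "monic f" using e p0 p(1) monic_mult_cancel by auto
      then show ?thesis using f by auto
    next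
      case False
      then have "coprime e p" using irreducible_imp_coprime_poly[OF p(2)] coprime_commute by blast
      then have "e dvd D" using e coprime_poly_dvd_mult[of e p D] by blast
      then show ?thesis using e by blast
    qed
  qed (use p in \<open>auto intro: monic_mult\<close>)
  moreover have "p * f \<notin> ?E" for f using np[of "p * f"] by auto
  then have "?E \<inter> (*) p ` ?E = {}" by blast
  ultimately have "M_euler (p * D) u = M_euler D u +
      (\<Sum>e\<in>(*) p ` ?E. of_int (moebius_poly e) * u ^ degree e)"
    using fin by (simp add: M_euler_def sum.union_disjoint)
  also have "(\<Sum>e\<in>(*) p ` ?E. of_int (moebius_poly e) * u ^ degree e) =
      (\<Sum>e\<in>?E. of_int (moebius_poly (p * e)) * u ^ degree (p * e))"
    using p0 by (subst sum.reindex) (auto simp: inj_on_def)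
  also have "\<dots> = (\<Sum>e\<in>?E. - (u ^ degree p) * (of_int (moebius_poly e) * u ^ degree e))"
  proof (rule sum.cong[OF refl])
    fix e assume e: "e \<in> ?E"
    then have "e \<noteq> 0" by auto
    moreover have "p * e dvd p * D" using e by (simp add: mult_dvd_mono)
    then have "squarefree (p * e)" using sf by (rule squarefree_mono)
    ultimately show "of_int (moebius_poly (p * e)) * u ^ degree (p * e) =
        - (u ^ degree p) * (of_int (moebius_poly e) * u ^ degree e)"
      using np[OF e] p p0 by (simp add: moebius_poly_prime_mult degree_mult_eq power_add)
  qed
  also have "\<dots> = - (u ^ degree p) * M_euler D u" unfolding M_euler_def by (rule sum_distrib_left[symmetric])
  finally show ?thesis by (simp add: algebra_simps)
qed

text \<open>Division by \<open>p\<close> maps the multiples of \<open>p\<close> in the left set onto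
  the set of degree \<open>k - degree p\<close>. For generating functions this is multiplication by
  \<open>1 - u ^ degree p\<close>.\<close>

lemma card_coprime_monics_prime_mult:
  assumes p: "monic p" "irreducible p" "\<not> p dvd D" "(D :: 'a::{field,finite} poly) \<noteq> 0"
  shows "card (coprime_monics D k) = card (coprime_monics (p * D) k) +
    (if degree p \<le> k then card (coprime_monics D (k - degree p)) else 0)"
proof -
  have p0: "p \<noteq> 0" using p by auto
  have cop: "coprime b p \<longleftrightarrow> \<not> p dvd b" for b
    using irreducible_imp_coprime_poly[OF p(2), of b] irreducible_not_unit[OF p(2)]
    by (auto simp: coprime_commute dest: coprime_common_divisor)
  have pD: "coprime p D" using irreducible_imp_coprime_poly[OF p(2,3)] .
  let ?C = "if degree p \<le> k then coprime_monics D (k - degree p) else {}"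
  have "coprime_monics D k = coprime_monics (p * D) k \<union> (*) p ` ?C"
  proof (intro equalityI subsetI)
    fix b assume b: "b \<in> coprime_monics D k"
    show "b \<in> coprime_monics (p * D) k \<union> (*) p ` ?C"
    proof (cases "p dvd b")
      case True
      then obtain c where c: "b = p * c" by (rule dvdE)
      then have "monic c" "coprime c D" using b p(1) monic_mult_cancel
        by (auto simp: coprime_monics_def coprime_poly_mult_left_iff)
      moreover from this have "c \<noteq> 0" by auto
      then have "degree p + degree c = k" using b p0 by (auto simp: c coprime_monics_def degree_mult_eq)
      ultimately show ?thesis using c by (auto simp: coprime_monics_def)
    next
      case False
      then show ?thesis using b cop by (auto simp: coprime_monics_def coprime_poly_mult_right_iff)
    qed
  next
    fix b assume "b \<in> coprime_monics (p * D) k \<union> (*) p ` ?C"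
    then show "b \<in> coprime_monics D k"
    proof
      assume "b \<in> (*) p ` ?C"
      then obtain c where b: "b = p * c" and "c \<in> ?C" by blast
      then have c: "monic c" "coprime c D" "degree c = k - degree p" "degree p \<le> k"
        by (auto simp: coprime_monics_def split: if_splits)
      then have "c \<noteq> 0" by auto
      have "monic b" unfolding b using p(1) c(1) by (rule monic_mult)
      moreover have "degree b = k" using b c p0 \<open>c \<noteq> 0\<close> by (simp add: degree_mult_eq)
      moreover have "coprime b D" using b c pD by (simp add: coprime_poly_mult_left_iff)
      ultimately show ?thesis unfolding coprime_monics_def by blast
    qed (auto simp: coprime_monics_def coprime_poly_mult_right_iff)
  qed
  moreover have "p * c \<notin> coprime_monics (p * D) k" for c
    using cop[of "p * c"] by (simp add: coprime_monics_def coprime_poly_mult_right_iff)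
  then have "coprime_monics (p * D) k \<inter> (*) p ` ?C = {}" by blast
  moreover have "inj_on ((*) p) ?C" using p0 by (auto simp: inj_on_def)
  ultimately show ?thesis by (simp add: card_Un_disjoint card_image)
qed

text \<open>The base case is every nonzero constant because \<open>D\<close> is not normalised to be
  monic.\<close>

lemma squarefree_poly_induct [consumes 2, case_names const prime]:
  fixes D :: "'a::{field,finite} poly"
  assumes "squarefree D" "D \<noteq> 0"
    and const: "\<And>D. D \<noteq> 0 \<Longrightarrow> degree D = 0 \<Longrightarrow> P D"
    and prime: "\<And>p D. monic p \<Longrightarrow> irreducible p \<Longrightarrow> \<not> p dvd D \<Longrightarrow> squarefree (p * D) \<Longrightarrow> D \<noteq> 0 \<Longrightarrow> P D \<Longrightarrow> P (p * D)"
  shows "P D"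
  using assms(1,2)
proof (induction "degree D" arbitrary: D rule: less_induct)
  case less
  show ?case
  proof (cases "degree D = 0")
    case False
    then obtain p where p: "monic p" "irreducible p" "p dvd D"
      using exists_monic_irreducible_dvd less.prems(2) by blast
    then obtain D' where D': "D = p * D'" by (auto elim: dvdE)
    then have "D' \<noteq> 0" "p \<noteq> 0" using less.prems by auto
    then have "degree D' < degree D" using D' irreducible_degree_pos[OF p(2)] by (simp add: degree_mult_eq)
    moreover have "squarefree D'" using less.prems(1) unfolding D' by (rule squarefree_multD)
    ultimately have "P D'" using less.hyps \<open>D' \<noteq> 0\<close> by simp
    moreover have "\<not> p dvd D'"
    proof
      assume "p dvd D'"
      then have "p\<^sup>2 dvd D" unfolding D' power2_eq_square by (rule mult_dvd_mono[OF dvd_refl])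
      then show False using less.prems(1) squarefreeD irreducible_not_unit[OF p(2)] by blast
    qed
    ultimately show ?thesis using prime[of p D'] p less.prems \<open>D' \<noteq> 0\<close> by (simp add: D')
  qed (use const less.prems in blast)
qed

lemma card_coprime_monics_const:
  assumes "(D :: 'a::{field,finite} poly) \<noteq> 0" "degree D = 0"
  shows "card (coprime_monics D k) = CARD('a) ^ k"
proof -
  have "is_unit D" using assms by (simp add: is_unit_poly_iff_degree)
  then have "coprime_monics D k = {b. monic b \<and> degree b = k}"
    by (auto simp: coprime_monics_def intro: is_unit_right_imp_coprime)
  then show ?thesis by (simp add: card_monic_degree)
qed

text \<open>The induction runs over counts of coprime monics for all
  \<open>k \<ge> degree D\<close>, since adjoining \<open>p\<close> refers to degree
  \<open>k - degree p\<close>; \<open>k = degree D\<close> gives the totient.\<close>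

lemma phi_poly_squarefree:
  assumes "squarefree D" "(D :: 'a::{field,finite} poly) \<noteq> 0"
  shows "real (phi_poly D) = real CARD('a) ^ degree D * M_euler D (inverse (real CARD('a)))"
proof -
  let ?q = "real CARD('a)"
  have "\<forall>k\<ge>degree D. real (card (coprime_monics D k)) = ?q ^ k * M_euler D (inverse ?q)"
    using assms
  proof (induction D rule: squarefree_poly_induct)
    case (const D)
    then show ?case by (simp add: card_coprime_monics_const M_euler_const)
  next
    case (prime p D)
    show ?case
    proof (intro allI impI)
      fix k assume k: "degree (p * D) \<le> k"
      have p0: "p \<noteq> 0" using prime by auto
      then have k': "degree D \<le> k - degree p" "degree p \<le> k" "degree D \<le> k"
        using k prime by (simp_all add: degree_mult_eq)
      have "real (card (coprime_monics (p * D) k)) =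
          real (card (coprime_monics D k)) - real (card (coprime_monics D (k - degree p)))"
        using card_coprime_monics_prime_mult[OF prime(1-3,5), of k] k' by simp
      also have "\<dots> = ?q ^ k * M_euler D (inverse ?q) - ?q ^ (k - degree p) * M_euler D (inverse ?q)"
        using prime k' by simp
      also have "?q ^ (k - degree p) = ?q ^ k * inverse ?q ^ degree p"
        using k' by (simp add: power_diff power_inverse divide_inverse)
      finally have "real (card (coprime_monics (p * D) k)) =
          ?q ^ k * (M_euler D (inverse ?q) * (1 - inverse ?q ^ degree p))" by (simp add: algebra_simps)
      then show "real (card (coprime_monics (p * D) k)) = ?q ^ k * M_euler (p * D) (inverse ?q)"
        by (simp only: M_euler_prime_mult[OF prime(1-5)])
    qed
  qed
  then have "real (card (coprime_monics D (degree D))) = ?q ^ degree D * M_euler D (inverse ?q)" by blast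
  then show ?thesis using card_coprime_monics[OF assms(2), of "degree D"] by simp
qed

text \<open>The zeta function of \<open>A\<close> without the factors at \<open>D\<close>: a
  geometric series for constant \<open>D\<close>, then one factor \<open>1 - u ^ degree p\<close>
  per prime.\<close>

lemma coprime_zeta_sums:
  assumes "squarefree D" "(D :: 'a::{field,finite} poly) \<noteq> 0" "\<bar>real CARD('a) * u\<bar> < 1"
  shows "(\<lambda>k. real (card (coprime_monics D k)) * u ^ k) sums (M_euler D u / (1 - real CARD('a) * u))"
  using assms(1,2)
proof (induction D rule: squarefree_poly_induct)
  case (const D)
  have "(\<lambda>k. (real CARD('a) * u) ^ k) sums (1 / (1 - real CARD('a) * u))"
    using assms(3) by (intro geometric_sums) simp
  then show ?case using const by (simp add: card_coprime_monics_const M_euler_const power_mult_distrib)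
next
  case (prime p D)
  let ?f = "\<lambda>k. real (card (coprime_monics D k)) * u ^ k" and ?d = "degree p"
  let ?S = "M_euler D u / (1 - real CARD('a) * u)"
  \<comment> \<open>The series multiplied by \<open>u ^ ?d\<close>; its first \<open>?d\<close>
    coefficients are 0, so the shift adds no initial terms.\<close>
  let ?g = "\<lambda>k. if ?d \<le> k then u ^ ?d * ?f (k - ?d) else 0"
  have "(\<lambda>k. ?g (k + ?d)) sums (u ^ ?d * ?S)" using sums_mult[OF prime(6), of "u ^ ?d"] by simp
  then have "?g sums (u ^ ?d * ?S + (\<Sum>k<?d. ?g k))" by (rule sums_iff_shift[THEN iffD1])
  then have "?g sums (u ^ ?d * ?S)" by simp
  then have "(\<lambda>k. ?f k - ?g k) sums (?S - u ^ ?d * ?S)" using prime by (intro sums_diff)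
  moreover have "?f k - ?g k = real (card (coprime_monics (p * D) k)) * u ^ k" for k
    using card_coprime_monics_prime_mult[OF prime(1-3,5), of k]
    by (auto simp: algebra_simps simp flip: power_add)
  moreover have "?S - u ^ ?d * ?S = M_euler (p * D) u / (1 - real CARD('a) * u)"
    unfolding M_euler_prime_mult[OF prime(1-5)] by (simp add: right_diff_distrib diff_divide_distrib mult_ac)
  ultimately show ?case by simp
qed

text \<open>The convolution identity says \<open>F * \<zeta>\<^sub>D(3) = \<zeta>\<^sub>D(2)\<close> for the Dirichlet series \<open>F\<close> of \<open>\<phi>\<close> at 3.\<close>

lemma phi_poly_sums:
  fixes D :: "'a::{field,finite} poly"
  assumes "squarefree D" "D \<noteq> 0"
  defines "x \<equiv> inverse (real CARD('a))"
  shows "M_euler D (x ^ 3) \<noteq> 0"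
    and "(\<lambda>k. real (\<Sum>b\<in>coprime_monics D k. phi_poly b) * (x ^ 3) ^ k) sums
      (M_euler D (x\<^sup>2) / M_euler D (x ^ 3) * ((1 - x\<^sup>2) / (1 - x)))"
proof -
  let ?q = "real CARD('a)"
  have q: "?q > 1" using CARD_field_gt_1[where 'a='a] by simp
  then have x: "0 < x" "x < 1" "?q * x = 1" by (simp_all add: x_def inverse_less_1_iff)
  \<comment> \<open>The denominators \<open>1 - q u\<close> of zeta at 2 and 3 thus become
    \<open>1 - x\<close> and \<open>1 - x ^ 2\<close>.\<close>
  have x2: "?q * x\<^sup>2 = x" and x3: "?q * x ^ 3 = x\<^sup>2"
    using x(3) by (simp_all add: power2_eq_square power3_eq_cube flip: mult.assoc)
  have x2': "x\<^sup>2 < 1" using x by (simp add: power_less_one_iff)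
  define a where "a = (\<lambda>k. real (card (coprime_monics D k)))"
  define f where "f = (\<lambda>k. real (\<Sum>b\<in>coprime_monics D k. phi_poly b))"
  have Z2: "(\<lambda>k. a k * (x\<^sup>2) ^ k) sums (M_euler D (x\<^sup>2) / (1 - x))"
    using coprime_zeta_sums[OF assms(1,2), of "x\<^sup>2"] x by (simp add: a_def x2)
  have Z3: "(\<lambda>k. a k * (x ^ 3) ^ k) sums (M_euler D (x ^ 3) / (1 - x\<^sup>2))"
    using coprime_zeta_sums[OF assms(1,2), of "x ^ 3"] x x2' by (simp add: a_def x3)
  have a_nonneg: "a k \<ge> 0" for k by (simp add: a_def)
  have "b = 1" if "monic b" "degree b = 0" for b :: "'a poly"
    using monic_unit[of b] monic_nonzero[OF that(1)] that by (simp add: is_unit_poly_iff_degree)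
  then have "coprime_monics D 0 = {1}" by (auto simp: coprime_monics_def)
  \<comment> \<open>The series at 3 has nonnegative terms and a positive first one, which keeps
    \<open>M_euler D (x ^ 3)\<close> away from 0.\<close>
  then have "a 0 * (x ^ 3) ^ 0 > 0" by (simp add: a_def)
  then have "(\<Sum>k. a k * (x ^ 3) ^ k) > 0"
    using Z3 x a_nonneg by (intro suminf_pos2[of _ 0]) (auto simp: sums_iff)
  then have pos: "M_euler D (x ^ 3) / (1 - x\<^sup>2) > 0" using Z3 by (simp add: sums_iff)
  then show nz: "M_euler D (x ^ 3) \<noteq> 0" by auto
  \<comment> \<open>At most \<open>q ^ k\<close> polynomials \<open>b\<close>, each with totient at
    most \<open>q ^ k\<close>; this suffices for absolute convergence in the Cauchy product.\<close>
  have f_le: "f k \<le> ?q ^ (2 * k)" for k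
  proof -
    have "phi_poly b \<le> CARD('a) ^ k" if "b \<in> coprime_monics D k" for b
    proof -
      have "phi_poly b \<le> card (deg_less (degree b) :: 'a poly set)"
        unfolding phi_poly_def by (rule card_mono) auto
      then show ?thesis using that by (simp add: card_deg_less coprime_monics_def)
    qed
    then have "(\<Sum>b\<in>coprime_monics D k. phi_poly b) \<le> card (coprime_monics D k) * CARD('a) ^ k"
      by (intro sum_bounded_above[THEN order_trans]) auto
    also have "\<dots> \<le> CARD('a) ^ k * CARD('a) ^ k" by (intro mult_right_mono card_coprime_monics_le) auto
    finally have "(\<Sum>b\<in>coprime_monics D k. phi_poly b) \<le> CARD('a) ^ (2 * k)" by (simp add: mult_2 power_add)
    then show ?thesis unfolding f_def by (metis of_nat_le_iff of_nat_power)
  qed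
  have bound: "norm (f k * (x ^ 3) ^ k) \<le> x ^ k" for k
  proof -
    have "f k * (x ^ 3) ^ k \<le> ?q ^ (2 * k) * (x ^ 3) ^ k"
      using x f_le by (intro mult_right_mono) auto
    also have "\<dots> = (?q ^ 2 * x ^ 3) ^ k" by (simp add: power_mult power_mult_distrib)
    also have "?q ^ 2 * x ^ 3 = x" using x3 x2 by (simp add: power2_eq_square mult.assoc)
    finally show ?thesis using x by (simp add: f_def sum_nonneg)
  qed
  have sf: "summable (\<lambda>k. norm (f k * (x ^ 3) ^ k))"
    by (rule summable_comparison_test'[of "\<lambda>k. x ^ k" 0]) (use x bound in \<open>auto intro!: summable_geometric\<close>)
  have sa: "summable (\<lambda>k. norm (a k * (x ^ 3) ^ k))" using Z3 x a_nonneg by (simp add: sums_iff abs_mult)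
  have "(\<Sum>k. f k * (x ^ 3) ^ k) * (\<Sum>k. a k * (x ^ 3) ^ k) =
      (\<Sum>k. \<Sum>i\<le>k. f i * (x ^ 3) ^ i * (a (k - i) * (x ^ 3) ^ (k - i)))"
    by (rule Cauchy_product[OF sf sa])
  also have "\<dots> = (\<Sum>k. a k * (x\<^sup>2) ^ k)"
  proof (rule suminf_cong)
    fix k
    have "(\<Sum>i\<le>k. f i * (x ^ 3) ^ i * (a (k - i) * (x ^ 3) ^ (k - i))) =
        (\<Sum>i\<le>k. f i * a (k - i)) * (x ^ 3) ^ k"
      unfolding sum_distrib_right
    proof (rule sum.cong[OF refl])
      fix i assume "i \<in> {..k}"
      then have "(x ^ 3) ^ k = (x ^ 3) ^ i * (x ^ 3) ^ (k - i)" by (simp flip: power_add)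
      then show "f i * (x ^ 3) ^ i * (a (k - i) * (x ^ 3) ^ (k - i)) = f i * a (k - i) * (x ^ 3) ^ k"
        by (simp only: mult_ac)
    qed
    also have "(\<Sum>i\<le>k. f i * a (k - i)) = ?q ^ k * a k"
      using arg_cong[OF phi_poly_convolution[of D k], of real] by (simp add: f_def a_def)
    also have "?q ^ k * a k * (x ^ 3) ^ k = a k * (?q * x ^ 3) ^ k" by (simp add: power_mult_distrib mult_ac)
    finally show "(\<Sum>i\<le>k. f i * (x ^ 3) ^ i * (a (k - i) * (x ^ 3) ^ (k - i))) = a k * (x\<^sup>2) ^ k"
      by (simp only: x3)
  qed
  finally have "(\<Sum>k. f k * (x ^ 3) ^ k) * (M_euler D (x ^ 3) / (1 - x\<^sup>2)) = M_euler D (x\<^sup>2) / (1 - x)"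
    using Z2 Z3 by (simp add: sums_iff)
  then have "(\<Sum>k. f k * (x ^ 3) ^ k) = M_euler D (x\<^sup>2) / M_euler D (x ^ 3) * ((1 - x\<^sup>2) / (1 - x))"
    using nz x x2' by (simp add: field_simps)
  then show "(\<lambda>k. real (\<Sum>b\<in>coprime_monics D k. phi_poly b) * (x ^ 3) ^ k) sums
      (M_euler D (x\<^sup>2) / M_euler D (x ^ 3) * ((1 - x\<^sup>2) / (1 - x)))"
    using summable_norm_cancel[OF sf] by (simp add: f_def sums_iff)
qed

section \<open>The average of the \<open>L\<close>-values\<close>

lemma monic_square_inject:
  assumes "odd CARD('a)" "monic (b :: 'a::{field,finite} poly)" "monic c" "b\<^sup>2 = c\<^sup>2"
  shows "b = c"
proof (rule ccontr)
  assume "b \<noteq> c"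
  then have "b = - c" using assms(4) by (simp add: power2_eq_iff)
  then have "(1::'a) = - 1" using assms(2,3) by simp
  then have "(2::'a) = 0" by (simp add: eq_neg_iff_add_eq_0)
  then show False using two_neq_0_field[OF assms(1)] by simp
qed

definition coprime_degree :: "'a::{field,finite} poly \<Rightarrow> nat \<Rightarrow> 'a poly set"
  where "coprime_degree N l = {m. m \<noteq> 0 \<and> degree m = l \<and> coprime m N}"

lemma finite_coprime_degree [simp, intro]: "finite (coprime_degree N l)"
  by (rule finite_subset[of _ "deg_less (Suc l)"]) (auto simp: coprime_degree_def deg_less_iff)

text \<open>Degree exactly \<open>l\<close> is a difference of two sets \<open>deg_less k\<close>
  with \<open>k \<ge> l\<close>, hence 4 = 2 + 2. The bound on \<open>degree a\<close> gives
  \<open>2 * (degree a + degree D) - k < l + 4 * degree D\<close>.\<close>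

lemma sum_Jacobi_symbol_bound:
  fixes D a :: "'a::{field,finite} poly"
  assumes odd: "odd CARD('a)" and D: "D \<noteq> 0" and a: "monic a" "\<nexists>b. monic b \<and> a = b\<^sup>2"
    and l: "degree a < degree D + l"
  shows "\<bar>\<Sum>m\<in>coprime_degree D l. real_of_int (Jacobi_symbol m a)\<bar> \<le> 4 * sqrt (real CARD('a) ^ (l + 4 * degree D))"
proof -
  let ?q = "real CARD('a)"
  obtain p j a' where p: "monic p" "irreducible p" "a = p ^ j * a'" "odd j" "\<not> p dvd a'"
    using monic_square_or_odd_prime_power[OF a(1)] a(2) by metis
  define \<psi> where "\<psi> = (\<lambda>x. real_of_int (Jacobi_symbol x a) * of_bool (coprime x D))"
  interpret real_character "a * D" \<psi>
    unfolding \<psi>_def by (rule real_character_Jacobi_symbol[OF odd a(1) p D])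
  have "a \<noteq> 0" using a by auto
  then have deg: "degree (a * D) = degree a + degree D" using D by (simp add: degree_mult_eq)
  have bound: "\<bar>\<Sum>x\<in>deg_less k. \<psi> x\<bar> \<le> 2 * sqrt (?q ^ (l + 4 * degree D))" if "k \<ge> l" for k
  proof -
    have "\<bar>\<Sum>x\<in>deg_less k. \<psi> x\<bar> \<le> 2 * sqrt (?q ^ (2 * degree (a * D) - k))" by (rule polya_vinogradov)
    also have "\<dots> \<le> 2 * sqrt (?q ^ (l + 4 * degree D))"
      using that l CARD_field_gt_1[where 'a='a] unfolding deg
      by (intro mult_left_mono real_sqrt_le_mono power_increasing) auto
    finally show ?thesis .
  qed
  have "(\<Sum>m\<in>coprime_degree D l. real_of_int (Jacobi_symbol m a)) = (\<Sum>x\<in>deg_less (Suc l) - deg_less l. \<psi> x)"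
    unfolding degree_eq_conv_deg_less[symmetric]
    by (rule sum.mono_neutral_cong_left)
      (auto simp: coprime_degree_def \<psi>_def intro: finite_subset[of _ "deg_less (Suc l)"] simp: deg_less_iff)
  also have "\<dots> = (\<Sum>x\<in>deg_less (Suc l). \<psi> x) - (\<Sum>x\<in>deg_less l. \<psi> x)"
    by (rule sum_diff) (auto simp: deg_less_mono)
  finally show ?thesis using bound[of l] bound[of "Suc l"] by linarith
qed

text \<open>A prime of the squarefree \<open>D\<close> divides \<open>D * m\<close> exactly once
  because \<open>m\<close> is coprime to \<open>D\<close>, so the \<open>L\<close>-series stops at
  \<open>degree D + l\<close>, a length independent of \<open>m\<close>; this allows the
  interchange.\<close>

lemma sum_L_poly_eq:
  fixes D :: "'a::{field,finite} poly"
  assumes odd: "odd CARD('a)" and D: "degree D > 0" "squarefree D"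
  shows "(\<Sum>m\<in>coprime_degree D l. L_poly 1 (D * m)) = complex_of_real (\<Sum>n<degree D + l.
    inverse (real CARD('a) ^ n) * (\<Sum>a | monic a \<and> degree a = n. of_int (Jacobi_symbol D a) *
      (\<Sum>m\<in>coprime_degree D l. of_int (Jacobi_symbol m a))))"
proof -
  have D0: "D \<noteq> 0" using D by auto
  then obtain p where p: "monic p" "irreducible p" "p dvd D"
    using exists_monic_irreducible_dvd D(1) by blast
  then obtain D1 where D1: "D = p * D1" by (auto elim: dvdE)
  have L: "L_poly 1 (D * m) = complex_of_real (\<Sum>n<degree D + l. inverse (real CARD('a) ^ n) *
      (\<Sum>a | monic a \<and> degree a = n. of_int (Jacobi_symbol D a) * of_int (Jacobi_symbol m a)))"
    if m: "m \<in> coprime_degree D l" for m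
  proof -
    have "\<not> p\<^sup>2 dvd D * m"
    proof
      assume "p\<^sup>2 dvd D * m"
      then have "p dvd D1 * m" using p by (auto simp: D1 power2_eq_square mult.assoc)
      then consider "p dvd D1" | "p dvd m" using p irreducible_dvd_mult_iff by blast
      then show False
      proof cases
        case 1
        then have "p\<^sup>2 dvd D" unfolding D1 power2_eq_square by (rule mult_dvd_mono[OF dvd_refl])
        then show False using D(2) squarefreeD irreducible_not_unit[OF p(2)] by blast
      next
        case 2
        then show False using m p irreducible_not_unit[OF p(2)]
          by (auto simp: coprime_degree_def dest: coprime_common_divisor)
      qed
    qed
    moreover have "p dvd D * m" using p(3) by simp
    moreover have "degree (D * m) = degree D + l" using m D0 by (simp add: coprime_degree_def degree_mult_eq)
    ultimately have "L_poly 1 (D * m) = complex_of_real (\<Sum>n<degree D + l. inverse (real CARD('a) ^ n) *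
      (\<Sum>a | monic a \<and> degree a = n. of_int (Jacobi_symbol (D * m) a)))"
      using L_poly_1_eq[OF odd p(1,2), of "D * m"] by simp
    also have "(\<lambda>n. \<Sum>a | monic a \<and> degree a = n. real_of_int (Jacobi_symbol (D * m) a)) =
        (\<lambda>n. \<Sum>a | monic a \<and> degree a = n. of_int (Jacobi_symbol D a) * of_int (Jacobi_symbol m a))"
      by (intro ext sum.cong refl) (auto simp: Jacobi_symbol_mult_left[OF odd])
    finally show ?thesis .
  qed
  have "(\<Sum>m\<in>coprime_degree D l. L_poly 1 (D * m)) = complex_of_real (\<Sum>m\<in>coprime_degree D l.
      \<Sum>n<degree D + l. inverse (real CARD('a) ^ n) *
      (\<Sum>a | monic a \<and> degree a = n. of_int (Jacobi_symbol D a) * of_int (Jacobi_symbol m a)))"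
    unfolding of_real_sum[of _ "coprime_degree D l"] by (intro sum.cong refl L)
  also have "(\<Sum>m\<in>coprime_degree D l.
      \<Sum>n<degree D + l. inverse (real CARD('a) ^ n) *
      (\<Sum>a | monic a \<and> degree a = n. of_int (Jacobi_symbol D a) * of_int (Jacobi_symbol m a))) =
    (\<Sum>n<degree D + l. inverse (real CARD('a) ^ n) * (\<Sum>m\<in>coprime_degree D l.
      \<Sum>a | monic a \<and> degree a = n. of_int (Jacobi_symbol D a) * of_int (Jacobi_symbol m a)))"
    by (subst sum.swap) (simp add: sum_distrib_left)
  also have "\<dots> = (\<Sum>n<degree D + l.
    inverse (real CARD('a) ^ n) * (\<Sum>a | monic a \<and> degree a = n. of_int (Jacobi_symbol D a) *
      (\<Sum>m\<in>coprime_degree D l. of_int (Jacobi_symbol m a))))"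
  proof (rule sum.cong[OF refl])
    fix n
    show "inverse (real CARD('a) ^ n) * (\<Sum>m\<in>coprime_degree D l.
      \<Sum>a | monic a \<and> degree a = n. of_int (Jacobi_symbol D a) * of_int (Jacobi_symbol m a)) =
      inverse (real CARD('a) ^ n) * (\<Sum>a | monic a \<and> degree a = n. of_int (Jacobi_symbol D a) *
      (\<Sum>m\<in>coprime_degree D l. of_int (Jacobi_symbol m a)))"
      unfolding sum_distrib_left[of "of_int _"] by (subst sum.swap) (rule refl)
  qed
  finally show ?thesis .
qed

section \<open>Square and nonsquare lower arguments\<close>

text \<open>At \<open>b ^ 2\<close> the symbol is the indicator of coprimality to \<open>b\<close>,
  so the inner sum counts the \<open>m\<close> coprime to \<open>D * b\<close>. For odd
  \<open>q\<close> the monic root \<open>b\<close> of a square is unique.\<close>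

lemma sum_monic_squares:
  fixes D :: "'a::{field,finite} poly"
  assumes odd: "odd CARD('a)"
  shows "(\<Sum>a | monic a \<and> degree a = n \<and> (\<exists>b. monic b \<and> a = b\<^sup>2). of_int (Jacobi_symbol D a) *
      (\<Sum>m\<in>coprime_degree D l. of_int (Jacobi_symbol m a))) =
    (if even n then \<Sum>b\<in>coprime_monics D (n div 2). real (card (coprime_degree (D * b) l)) else 0)"
proof -
  have deg: "degree (b\<^sup>2) = 2 * degree b" if "monic b" for b :: "'a poly"
    using that monic_nonzero[OF that] by (simp add: degree_power_eq)
  have sq: "of_int (Jacobi_symbol c (b\<^sup>2)) = (of_bool (coprime c b) :: real)" if "monic b" for b c :: "'a poly"
  proof -
    have "Jacobi_symbol c (b\<^sup>2) = \<bar>Jacobi_symbol c b\<bar>\<^sup>2"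
      using monic_nonzero[OF that] by (simp add: Jacobi_symbol_power_right)
    then show ?thesis using that by (simp add: abs_Jacobi_symbol)
  qed
  show ?thesis
  proof (cases "even n")
    case False
    then have empty: "{a :: 'a poly. monic a \<and> degree a = n \<and> (\<exists>b. monic b \<and> a = b\<^sup>2)} = {}"
      using deg by auto
    show ?thesis unfolding empty using False by simp
  next
    case True
    let ?B = "{b :: 'a poly. monic b \<and> degree b = n div 2}"
    have "{a :: 'a poly. monic a \<and> degree a = n \<and> (\<exists>b. monic b \<and> a = b\<^sup>2)} = (\<lambda>b. b\<^sup>2) ` ?B"
      using deg True monic_power by (auto simp: image_iff)
    moreover have "inj_on (\<lambda>b. b\<^sup>2) ?B" using monic_square_inject[OF odd] by (auto simp: inj_on_def)
    ultimately have "(\<Sum>a | monic a \<and> degree a = n \<and> (\<exists>b. monic b \<and> a = b\<^sup>2). of_int (Jacobi_symbol D a) *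
        (\<Sum>m\<in>coprime_degree D l. of_int (Jacobi_symbol m a))) =
        (\<Sum>b\<in>?B. of_int (Jacobi_symbol D (b\<^sup>2)) * (\<Sum>m\<in>coprime_degree D l. real_of_int (Jacobi_symbol m (b\<^sup>2))))"
      by (simp add: sum.reindex)
    also have "\<dots> = (\<Sum>b\<in>?B. of_bool (coprime D b) * real (card (coprime_degree (D * b) l)))"
    proof (rule sum.cong[OF refl])
      fix b assume "b \<in> ?B"
      then have b: "monic b" by blast
      have "coprime_degree D l \<inter> {m. coprime m b} = coprime_degree (D * b) l"
        by (auto simp: coprime_degree_def coprime_poly_mult_right_iff)
      then show "of_int (Jacobi_symbol D (b\<^sup>2)) * (\<Sum>m\<in>coprime_degree D l. real_of_int (Jacobi_symbol m (b\<^sup>2))) =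
          of_bool (coprime D b) * real (card (coprime_degree (D * b) l))"
        by (simp add: sq[OF b] sum_of_bool_eq)
    qed
    also have "\<dots> = (\<Sum>b\<in>coprime_monics D (n div 2). real (card (coprime_degree (D * b) l)))"
      by (rule sum.mono_neutral_cong_right) (auto simp: coprime_monics_def coprime_commute)
    finally show ?thesis using True by simp
  qed
qed

text \<open>An infinite series with a cutoff is the form to which dominated convergence
  applies.\<close>

lemma sum_even:
  "(\<Sum>n<N. if even n then f (n div 2) else 0) = (\<Sum>k. if 2 * k < N then f k else 0 :: real)"
proof -
  have "(\<Sum>k. if 2 * k < N then f k else 0) = (\<Sum>k<N. if 2 * k < N then f k else 0)"
    by (rule suminf_finite) auto
  also have "\<dots> = (\<Sum>k | 2 * k < N. f k)"
    by (rule sum.mono_neutral_cong_right) auto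
  also have "\<dots> = (\<Sum>n | n < N \<and> even n. f (n div 2))"
    by (rule sum.reindex_bij_witness[of _ "\<lambda>n. n div 2" "\<lambda>k. 2 * k"]) auto
  also have "\<dots> = (\<Sum>n<N. if even n then f (n div 2) else 0)"
    by (rule sum.mono_neutral_cong_left) auto
  finally show ?thesis by simp
qed

text \<open>The contribution of the squares \<open>a = b\<^sup>2\<close> with \<open>degree b = k\<close> to the sum over \<open>m\<close> of degree \<open>l\<close>.\<close>

definition square_term :: "'a::{field,finite} poly \<Rightarrow> nat \<Rightarrow> nat \<Rightarrow> real"
  where "square_term D l k = inverse (real CARD('a) ^ (2 * k)) *
    (\<Sum>b\<in>coprime_monics D k. real (card (coprime_degree (D * b) l)))"

text \<open>In each degree \<open>n\<close> there are at most \<open>q ^ n\<close> nonsquares, and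
  the weight \<open>q ^ (-n)\<close> cancels their number: every degree costs the bound for one
  single \<open>a\<close>.\<close>

lemma sum_L_poly_bound:
  fixes D :: "'a::{field,finite} poly"
  assumes odd: "odd CARD('a)" and D: "degree D > 0" "squarefree D"
  shows "norm ((\<Sum>m\<in>coprime_degree D l. L_poly 1 (D * m)) -
      complex_of_real (\<Sum>k. if 2 * k < degree D + l then square_term D l k else 0)) \<le>
    real (degree D + l) * (4 * sqrt (real CARD('a) ^ (l + 4 * degree D)))"
proof -
  let ?q = "real CARD('a)"
  define f where "f = (\<lambda>a :: 'a poly. of_int (Jacobi_symbol D a) * (\<Sum>m\<in>coprime_degree D l. real_of_int (Jacobi_symbol m a)))"
  define Sq where "Sq = {a :: 'a poly. \<exists>b. monic b \<and> a = b\<^sup>2}"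
  have D0: "D \<noteq> 0" using D by auto
  have q: "?q > 0" by simp
  have split: "(\<Sum>a | monic a \<and> degree a = n. f a) =
      (\<Sum>a | monic a \<and> degree a = n \<and> a \<in> Sq. f a) + (\<Sum>a | monic a \<and> degree a = n \<and> a \<notin> Sq. f a)" for n
    by (subst sum.union_disjoint[symmetric])
      (auto intro: finite_subset[OF _ finite_monic_degree[of n]] intro!: sum.cong)
  have "(\<Sum>a | monic a \<and> degree a = n \<and> a \<in> Sq. f a) =
      (if even n then \<Sum>b\<in>coprime_monics D (n div 2). real (card (coprime_degree (D * b) l)) else 0)" for n
    using sum_monic_squares[OF odd, where D = D and n = n and l = l] by (simp add: f_def Sq_def)
  then have "(\<Sum>n<degree D + l. inverse (?q ^ n) * (\<Sum>a | monic a \<and> degree a = n \<and> a \<in> Sq. f a)) =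
      (\<Sum>n<degree D + l. if even n then square_term D l (n div 2) else 0)"
    by (intro sum.cong refl) (simp add: square_term_def)
  also have "\<dots> = (\<Sum>k. if 2 * k < degree D + l then square_term D l k else 0)" by (rule sum_even)
  finally have sq: "(\<Sum>n<degree D + l. inverse (?q ^ n) * (\<Sum>a | monic a \<and> degree a = n \<and> a \<in> Sq. f a)) = \<dots>" .
  have "(\<Sum>m\<in>coprime_degree D l. L_poly 1 (D * m)) -
      complex_of_real (\<Sum>k. if 2 * k < degree D + l then square_term D l k else 0) =
      complex_of_real (\<Sum>n<degree D + l. inverse (?q ^ n) * (\<Sum>a | monic a \<and> degree a = n \<and> a \<notin> Sq. f a))"
    unfolding sum_L_poly_eq[OF odd D] sq[symmetric] f_def[symmetric] split distrib_left sum.distrib by simp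
  then have "norm ((\<Sum>m\<in>coprime_degree D l. L_poly 1 (D * m)) -
      complex_of_real (\<Sum>k. if 2 * k < degree D + l then square_term D l k else 0)) =
      \<bar>\<Sum>n<degree D + l. inverse (?q ^ n) * (\<Sum>a | monic a \<and> degree a = n \<and> a \<notin> Sq. f a)\<bar>"
    by (simp only: norm_of_real real_norm_def)
  also have "\<dots> \<le> (\<Sum>n<degree D + l. 4 * sqrt (?q ^ (l + 4 * degree D)))"
  proof (rule order_trans[OF sum_abs], rule sum_mono)
    fix n assume n: "n \<in> {..<degree D + l}"
    let ?c = "4 * sqrt (?q ^ (l + 4 * degree D))"
    have "\<bar>f a\<bar> \<le> ?c" if "monic a" "degree a = n" "a \<notin> Sq" for a
    proof -
      have "\<bar>real_of_int (Jacobi_symbol D a)\<bar> \<le> 1"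
        using abs_Jacobi_symbol[OF that(1), of D] by (simp flip: of_int_abs)
      moreover have "\<bar>\<Sum>m\<in>coprime_degree D l. real_of_int (Jacobi_symbol m a)\<bar> \<le> ?c"
        using that n by (intro sum_Jacobi_symbol_bound[OF odd D0]) (auto simp: Sq_def)
      ultimately have "\<bar>f a\<bar> \<le> 1 * ?c" unfolding f_def abs_mult by (intro mult_mono) auto
      then show ?thesis by simp
    qed
    then have "(\<Sum>a | monic a \<and> degree a = n \<and> a \<notin> Sq. \<bar>f a\<bar>) \<le>
        (\<Sum>a | monic (a :: 'a poly) \<and> degree a = n \<and> a \<notin> Sq. ?c)" by (intro sum_mono) auto
    also have "\<dots> \<le> (\<Sum>a | monic (a :: 'a poly) \<and> degree a = n. ?c)"
      by (rule sum_mono2) auto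
    also have "\<dots> = ?q ^ n * ?c" by (simp add: card_monic_degree)
    finally have "\<bar>\<Sum>a | monic a \<and> degree a = n \<and> a \<notin> Sq. f a\<bar> \<le> ?q ^ n * ?c"
      using sum_abs order_trans by blast
    then have "\<bar>inverse (?q ^ n)\<bar> * \<bar>\<Sum>a | monic a \<and> degree a = n \<and> a \<notin> Sq. f a\<bar> \<le> \<bar>inverse (?q ^ n)\<bar> * (?q ^ n * ?c)"
      by (rule mult_left_mono) simp
    also have "\<dots> = ?c" using q by simp
    finally show "\<bar>inverse (?q ^ n) * (\<Sum>a | monic a \<and> degree a = n \<and> a \<notin> Sq. f a)\<bar> \<le> ?c"
      by (simp only: abs_mult)
  qed
  finally show ?thesis by simp
qed

text \<open>Tannery's theorem: for fixed \<open>k\<close> the term is eventually constant in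
  \<open>l\<close>, and \<open>q * x ^ k\<close> dominates it for all \<open>l\<close>.\<close>

lemma square_terms_tendsto:
  fixes D :: "'a::{field,finite} poly"
  assumes D: "D \<noteq> 0" "squarefree D"
  defines "x \<equiv> inverse (real CARD('a))"
  shows "(\<lambda>l. x ^ l * (\<Sum>k. if 2 * k < degree D + l then square_term D l k else 0)) \<longlonglongrightarrow>
    M_euler D x * M_euler D (x\<^sup>2) / M_euler D (x ^ 3) * real CARD('a) * (1 - x\<^sup>2)"
proof -
  let ?q = "real CARD('a)" and ?d = "degree D"
  have q: "?q > 1" using CARD_field_gt_1[where 'a='a] by simp
  then have x: "0 < x" "x < 1" "?q * x = 1" by (simp_all add: x_def inverse_less_1_iff)
  have qx: "?q ^ k * x ^ k = 1" for k using x(3) by (simp flip: power_mult_distrib)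
  define \<Phi> where "\<Phi> = (\<lambda>k. real (\<Sum>b\<in>coprime_monics D k. phi_poly b))"
  define t where "t = (\<lambda>k l. if 2 * k < ?d + l then x ^ l * square_term D l k else 0)"
  define s where "s = (\<lambda>k. (?q - 1) * M_euler D x * (\<Phi> k * (x ^ 3) ^ k))"
  have phi_D: "x ^ ?d * real (phi_poly D) = M_euler D x"
    using phi_poly_squarefree[OF D(2,1)] qx[of ?d] by (simp add: x_def[symmetric] mult_ac)
  have "(\<lambda>k. \<Phi> k * (x ^ 3) ^ k) sums (M_euler D (x\<^sup>2) / M_euler D (x ^ 3) * ((1 - x\<^sup>2) / (1 - x)))"
    unfolding \<Phi>_def x_def by (rule phi_poly_sums(2)[OF D(2,1)])
  then have "s sums ((?q - 1) * M_euler D x * (M_euler D (x\<^sup>2) / M_euler D (x ^ 3) * ((1 - x\<^sup>2) / (1 - x))))"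
    unfolding s_def by (rule sums_mult)
  moreover have "(?q - 1) * M_euler D x * (M_euler D (x\<^sup>2) / M_euler D (x ^ 3) * ((1 - x\<^sup>2) / (1 - x))) =
      M_euler D x * M_euler D (x\<^sup>2) / M_euler D (x ^ 3) * ((?q - 1) / (1 - x)) * (1 - x\<^sup>2)"
    by (simp only: times_divide_eq_left times_divide_eq_right mult_ac)
  \<comment> \<open>As \<open>q x = 1\<close>, the \<open>q - 1\<close> possible leading
    coefficients of \<open>m\<close> cancel the denominator of zeta at 2 up to
    \<open>q\<close>.\<close>
  moreover have "(?q - 1) / (1 - x) = ?q" using x by (simp add: field_simps)
  ultimately have s_sum: "suminf s = M_euler D x * M_euler D (x\<^sup>2) / M_euler D (x ^ 3) * ?q * (1 - x\<^sup>2)"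
    by (simp add: sums_iff)
  have "(\<lambda>l. suminf (\<lambda>k. t k l)) \<longlonglongrightarrow> suminf s"
  proof (rule tannerys_theorem[THEN conjunct2, THEN conjunct2])
    fix k
    \<comment> \<open>This \<open>l\<close> passes the cutoff \<open>2 * k < ?d + l\<close> and is
      at least \<open>degree (D * b) = ?d + k\<close>, where the count of coprime \<open>m\<close>
      is exact.\<close>
    have "t k l = s k" if l: "l \<ge> ?d + 2 * k + 1" for l
    proof -
      have card: "real (card (coprime_degree (D * b) l)) =
          (?q - 1) * ?q ^ (l - (?d + k)) * (real (phi_poly D) * real (phi_poly b))"
        if b: "b \<in> coprime_monics D k" for b
      proof -
        have b': "b \<noteq> 0" "degree b = k" "coprime D b" using b by (auto simp: coprime_monics_def coprime_commute)
        then have "degree (D * b) = ?d + k" using D by (simp add: degree_mult_eq)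
        then show ?thesis
          using card_coprime_degree_eq[of "D * b" l] phi_poly_mult[of D b] b' D l
          by (simp add: coprime_degree_def)
      qed
      have "t k l = x ^ l * (inverse (?q ^ (2 * k)) *
          (\<Sum>b\<in>coprime_monics D k. (?q - 1) * ?q ^ (l - (?d + k)) * (real (phi_poly D) * real (phi_poly b))))"
        using l by (simp add: t_def square_term_def card)
      also have "\<dots> = (x ^ l * ?q ^ (l - (?d + k))) * inverse (?q ^ (2 * k)) * ((?q - 1) * real (phi_poly D) * \<Phi> k)"
        by (simp add: \<Phi>_def sum_distrib_left mult_ac)
      also have "x ^ l = x ^ (l - (?d + k)) * x ^ (?d + k)" using l by (simp flip: power_add)
      also have "x ^ (l - (?d + k)) * x ^ (?d + k) * ?q ^ (l - (?d + k)) = x ^ (?d + k)"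
        using qx[of "l - (?d + k)"] by (simp add: mult_ac)
      also have "inverse (?q ^ (2 * k)) = x ^ (2 * k)" by (simp add: x_def power_inverse)
      also have "x ^ (?d + k) * x ^ (2 * k) * ((?q - 1) * real (phi_poly D) * \<Phi> k) =
          (?q - 1) * (x ^ ?d * real (phi_poly D)) * (\<Phi> k * (x ^ k * x ^ (2 * k)))"
        by (simp add: power_add mult_ac)
      also have "x ^ k * x ^ (2 * k) = (x ^ 3) ^ k" by (simp flip: power_add power_mult)
      finally show ?thesis by (simp only: s_def phi_D)
    qed
    then show "(\<lambda>l. t k l) \<longlonglongrightarrow> s k"
      by (intro tendsto_eventually eventually_sequentiallyI[of "?d + 2 * k + 1"])
  next
    \<comment> \<open>At most \<open>q ^ k\<close> choices of \<open>b\<close> and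
      \<open>q ^ (l + 1)\<close> of \<open>m\<close>, against the weight
      \<open>q ^ (- l - 2 * k)\<close>.\<close>
    have "norm (t k l) \<le> ?q * x ^ k" for k l
    proof (cases "2 * k < ?d + l")
      case True
      have "(\<Sum>b\<in>coprime_monics D k. real (card (coprime_degree (D * b) l))) \<le>
          real (card (coprime_monics D k)) * ?q ^ Suc l"
        using card_coprime_degree_le by (intro sum_bounded_above) (auto simp: coprime_degree_def)
      also have "\<dots> \<le> ?q ^ k * ?q ^ Suc l"
        using card_coprime_monics_le[of D k] by (intro mult_right_mono) (auto simp flip: of_nat_power)
      finally have "t k l \<le> x ^ l * (inverse (?q ^ (2 * k)) * (?q ^ k * ?q ^ Suc l))"
        using True x by (simp add: t_def square_term_def mult_left_mono)
      also have "inverse (?q ^ (2 * k)) = x ^ k * x ^ k" by (simp add: x_def power_inverse mult_2 power_add)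
      also have "x ^ l * (x ^ k * x ^ k * (?q ^ k * ?q ^ Suc l)) = (?q ^ l * x ^ l) * (?q ^ k * x ^ k) * (?q * x ^ k)"
        by (simp only: power_Suc mult_ac)
      also have "\<dots> = ?q * x ^ k" by (simp add: qx)
      finally show ?thesis using True x by (simp add: t_def square_term_def sum_nonneg)
    next
      case False
      then show ?thesis using x by (simp add: t_def)
    qed
    then show "\<forall>\<^sub>F (k, l) in sequentially \<times>\<^sub>F sequentially. norm (t k l) \<le> ?q * x ^ k"
      by (intro always_eventually) auto
    show "summable (\<lambda>k. ?q * x ^ k)" using x by (intro summable_mult summable_geometric) simp
  qed simp
  moreover have "suminf (\<lambda>k. t k l) = x ^ l * (\<Sum>k. if 2 * k < ?d + l then square_term D l k else 0)" for l
  proof -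
    have "summable (\<lambda>k. if 2 * k < ?d + l then square_term D l k else 0)"
      by (rule summable_finite[of "{..<?d + l}"]) auto
    then show ?thesis by (subst suminf_mult[symmetric]) (auto simp: t_def intro!: suminf_cong)
  qed
  ultimately show ?thesis by (simp add: s_sum)
qed

theorem theorem7p5:
  fixes D :: "'a::{field,finite} poly"
  assumes "odd CARD('a)"
    and "degree D > 0"
    and "squarefree D"
  shows "(\<lambda>l. 1 / of_nat CARD('a) ^ l *
            (\<Sum>m | m \<noteq> 0 \<and> degree m = l \<and> coprime m D. L_poly 1 (D * m)))
         \<longlonglongrightarrow> M_poly D 1 * M_poly D 2 / M_poly D 3 *
               of_nat CARD('a) * (1 - 1 / of_nat CARD('a) ^ 2)"
proof -
  let ?q = "real CARD('a)" and ?d = "degree D"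
  define x where "x = inverse ?q"
  define L where "L = (\<lambda>l. \<Sum>m\<in>coprime_degree D l. L_poly 1 (D * m))"
  define S where "S = (\<lambda>l. \<Sum>k. if 2 * k < ?d + l then square_term D l k else 0)"
  have D0: "D \<noteq> 0" using assms(2) by auto
  have q: "?q > 1" using CARD_field_gt_1[where 'a='a] by simp
  have x: "0 < x" using q by (simp add: x_def)
  \<comment> \<open>This is \<open>q ^ (-1/2)\<close>: after division by \<open>q ^ l\<close> the
    error is of order \<open>(?d + l) * ?y ^ l\<close>.\<close>
  let ?y = "sqrt ?q * x"
  have "sqrt ?q < ?q" using q by (intro real_less_lsqrt) (simp_all add: power2_eq_square)
  then have "?y < ?q * x" using x by (rule mult_strict_right_mono)
  then have y: "0 \<le> ?y" "?y < 1" using q by (simp_all add: x_def)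
  have bound: "norm (of_real (x ^ l) * (L l - of_real (S l))) \<le>
      (4 * sqrt (?q ^ (4 * ?d))) * (real ?d * ?y ^ l + real l * ?y ^ l)" for l
  proof -
    have "norm (of_real (x ^ l) * (L l - of_real (S l))) = x ^ l * norm (L l - of_real (S l))"
      using x by (simp add: norm_mult norm_power)
    also have "\<dots> \<le> x ^ l * (real (?d + l) * (4 * sqrt (?q ^ (l + 4 * ?d))))"
      unfolding L_def S_def using x by (intro mult_left_mono sum_L_poly_bound assms) auto
    also have "\<dots> = (4 * sqrt (?q ^ (4 * ?d))) * (real ?d * ?y ^ l + real l * ?y ^ l)"
      by (simp add: power_add real_sqrt_mult real_sqrt_power power_mult_distrib algebra_simps)
    finally show ?thesis .
  qed
  have "(\<lambda>l. (4 * sqrt (?q ^ (4 * ?d))) * (real ?d * ?y ^ l + real l * ?y ^ l)) \<longlonglongrightarrow>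
      (4 * sqrt (?q ^ (4 * ?d))) * (real ?d * 0 + 0)"
    using y by (intro tendsto_intros LIMSEQ_realpow_zero powser_times_n_limit_0) auto
  then have "(\<lambda>l. (4 * sqrt (?q ^ (4 * ?d))) * (real ?d * ?y ^ l + real l * ?y ^ l)) \<longlonglongrightarrow> 0"
    by (simp only: mult_zero_right add_0_right)
  then have "(\<lambda>l. of_real (x ^ l) * (L l - of_real (S l))) \<longlonglongrightarrow> 0"
    by (rule Lim_null_comparison[rotated]) (rule always_eventually, rule allI, rule bound)
  moreover have "(\<lambda>l. complex_of_real (x ^ l * S l)) \<longlonglongrightarrow>
      complex_of_real (M_euler D x * M_euler D (x\<^sup>2) / M_euler D (x ^ 3) * ?q * (1 - x\<^sup>2))"
    unfolding S_def x_def by (intro tendsto_of_real square_terms_tendsto D0 assms)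
  ultimately have "(\<lambda>l. of_real (x ^ l) * (L l - of_real (S l)) + complex_of_real (x ^ l * S l)) \<longlonglongrightarrow>
      0 + complex_of_real (M_euler D x * M_euler D (x\<^sup>2) / M_euler D (x ^ 3) * ?q * (1 - x\<^sup>2))"
    by (rule tendsto_add)
  moreover have "of_real (x ^ l) * (L l - of_real (S l)) + complex_of_real (x ^ l * S l) =
      1 / of_nat CARD('a) ^ l * (\<Sum>m | m \<noteq> 0 \<and> degree m = l \<and> coprime m D. L_poly 1 (D * m))" for l
  proof -
    have "of_real (x ^ l) * (L l - of_real (S l)) + complex_of_real (x ^ l * S l) = of_real (x ^ l) * L l"
      by (simp add: right_diff_distrib)
    then show ?thesis by (simp add: L_def coprime_degree_def x_def divide_inverse power_inverse)
  qed
  moreover have M: "M_poly D 1 = complex_of_real (M_euler D x)" "M_poly D 2 = complex_of_real (M_euler D (x\<^sup>2))"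
    "M_poly D 3 = complex_of_real (M_euler D (x ^ 3))"
    using M_poly_eq[of D 1] M_poly_eq[of D 2] M_poly_eq[of D 3] by (simp_all add: x_def power_inverse)
  have "complex_of_real (M_euler D x * M_euler D (x\<^sup>2) / M_euler D (x ^ 3) * ?q * (1 - x\<^sup>2)) =
      M_poly D 1 * M_poly D 2 / M_poly D 3 * of_nat CARD('a) * (1 - 1 / of_nat CARD('a) ^ 2)"
    unfolding M by (simp add: x_def power_inverse divide_inverse)
  ultimately show ?thesis by (simp only: add_0_left)
qed

end
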